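(* Let $(\Omega,\mathcal{F})$ be a measurable space, let $\mathcal{X}$ be the set of bounded $\mathcal{F}$-measurable functions $\Omega\to\mathbb{R}$, and let $\mathcal{E}:\mathcal{X}\to\mathbb{R}$ be a regular sublinear expectation such that, for any sequence $\{A_n\}_{n\ge1}\subset\mathcal{F}$ with $\bigcup_{n\ge1}A_n=\Omega$ and $A_i\cap A_j=\emptyset$ for $i\ne j$, there exists a constant $M$ with $\sum_{n=1}^\infty C(A_n)<M$. Let $\{\xi_n\}_{n\ge1}\subset\mathcal{X}$ be an independent sequence under $\mathcal{E}$, and let $p>1$. If $$\sup_{i\ge1}\big[\mathcal{E}(\xi_i)+\mathcal{E}(-\xi_i)\big]<\infty\quad\text{and}\quad\sum_{i=1}^\infty\frac{1}{i^{2p}}\,\mathcal{E}\big[(\xi_i-\mathcal{E}(\xi_i))^2\big]<\infty,$$ then there exist constants $\{\lambda_i\}_{i\ge1}$ such that $$\lim_{n\to\infty}\frac{1}{n^p}\sum_{i=1}^n(\xi_i-\lambda_i)=0,\quad C\text{-q.s.}$$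
   Context: A functional $\mathcal{E}:\mathcal{X}\to\mathbb{R}$ is a sublinear expectation if: (i) $\xi_1\ge\xi_2$ implies $\mathcal{E}(\xi_1)\ge\mathcal{E}(\xi_2)$; (ii) $\mathcal{E}(\lambda)=\lambda$ for every constant $\lambda\in\mathbb{R}$; (iii) $\mathcal{E}(\xi_1+\xi_2)\le\mathcal{E}(\xi_1)+\mathcal{E}(\xi_2)$ for all $\xi_1,\xi_2\in\mathcal{X}$; (iv) $\mathcal{E}(\lambda\xi)=\lambda\mathcal{E}(\xi)$ for all $\lambda\ge 0$, $\xi\in\mathcal{X}$. It is regular if $\mathcal{E}(\xi_n)\downarrow0$ for every sequence $\{\xi_n\}\subset\mathcal{X}$ with $\xi_n\downarrow0$ (pointwise). $\{E_\mu;\mu\in\mathcal{M}\}$ denotes the set of all linear expectations (linear functionals on $\mathcal{X}$) dominated by $\mathcal{E}$, i.e. $E_\mu[\xi]\le\mathcal{E}(\xi)$ for all $\xi\in\mathcal{X}$; each such functional is identified with a finitely additive set function $\mu$ on $\mathcal{F}$, $\mu(A)=E_\mu[I_A]$. $\xi,\eta\in\mathcal{X}$ are uncorrelated with respect to $\mathcal{E}$ if $E_\mu[\xi\eta]=E_\mu[\xi]E_\mu[\eta]$ for every $\mu\in\mathcal{M}$. The capacity $C$ is defined by $C(A):=\mathcal{E}(I_A)$ for $A\in\mathcal{F}$. A set $A$ is $C$-polar if $C(A)=0$; a sequence converges $C$-q.s. if it converges pointwise outside a $C$-polar set. A sequence $\{\xi_n\}_{n\ge1}\subset\mathcal{X}$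 is independent under $\mathcal{E}$ if it is pairwise uncorrelated ($\xi_i,\xi_j$ uncorrelated with respect to $\mathcal{E}$ for all $i\neq j$) and for any $n>m\ge 1$, $A\in\sigma(\xi_1,\dots,\xi_m)$ and $B\in\sigma(\xi_{m+1},\dots,\xi_n)$, one has $C(A\cap B)\le C(A)C(B)$. *)

theory Defs
  imports "HOL-Analysis.Analysis"
begin

text \<open>
  A measurable space is represented by a measure \<open>M\<close> of which only \<open>space M\<close> and \<open>sets M\<close> are used.
  Functions on \<open>space M\<close> are represented by functions on the whole type. Since order, boundedness
  and measurability only look at \<open>space M\<close>, monotonicity (respectively domination) makes the
  functionals below independent of the values outside \<open>space M\<close>.
\<close>

definition bounded_measurable :: "'a measure \<Rightarrow> ('a \<Rightarrow> real) set" where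
  "bounded_measurable M = {f \<in> borel_measurable M. bounded (f ` space M)}"

definition sublinear_expectation :: "'a measure \<Rightarrow> (('a \<Rightarrow> real) \<Rightarrow> real) \<Rightarrow> bool" where
  "sublinear_expectation M E \<longleftrightarrow>
     (\<forall>f\<in>bounded_measurable M. \<forall>g\<in>bounded_measurable M.
        (\<forall>\<omega>\<in>space M. f \<omega> \<ge> g \<omega>) \<longrightarrow> E f \<ge> E g) \<and>
     (\<forall>c. E (\<lambda>_. c) = c) \<and>
     (\<forall>f\<in>bounded_measurable M. \<forall>g\<in>bounded_measurable M. E (\<lambda>\<omega>. f \<omega> + g \<omega>) \<le> E f + E g) \<and>
     (\<forall>c\<ge>0. \<forall>f\<in>bounded_measurable M. E (\<lambda>\<omega>. c * f \<omega>) = c * E f)"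

definition regular_expectation :: "'a measure \<Rightarrow> (('a \<Rightarrow> real) \<Rightarrow> real) \<Rightarrow> bool" where
  "regular_expectation M E \<longleftrightarrow>
     (\<forall>f :: nat \<Rightarrow> 'a \<Rightarrow> real.
        (\<forall>n. f n \<in> bounded_measurable M) \<longrightarrow>
        (\<forall>\<omega>\<in>space M. decseq (\<lambda>n. f n \<omega>) \<and> (\<lambda>n. f n \<omega>) \<longlonglongrightarrow> 0) \<longrightarrow>
        decseq (\<lambda>n. E (f n)) \<and> (\<lambda>n. E (f n)) \<longlonglongrightarrow> 0)"

text \<open>Positivity and preservation of constants of the members of this set follow from domination.\<close>

definition dominated_linear :: "'a measure \<Rightarrow> (('a \<Rightarrow> real) \<Rightarrow> real) \<Rightarrow> (('a \<Rightarrow> real) \<Rightarrow> real) set" where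
  "dominated_linear M E =
     {L. (\<forall>f\<in>bounded_measurable M. \<forall>g\<in>bounded_measurable M. L (\<lambda>\<omega>. f \<omega> + g \<omega>) = L f + L g) \<and>
         (\<forall>c. \<forall>f\<in>bounded_measurable M. L (\<lambda>\<omega>. c * f \<omega>) = c * L f) \<and>
         (\<forall>f\<in>bounded_measurable M. L f \<le> E f)}"

definition uncorrelated ::
  "'a measure \<Rightarrow> (('a \<Rightarrow> real) \<Rightarrow> real) \<Rightarrow> ('a \<Rightarrow> real) \<Rightarrow> ('a \<Rightarrow> real) \<Rightarrow> bool" where
  "uncorrelated M E f g \<longleftrightarrow> (\<forall>L\<in>dominated_linear M E. L (\<lambda>\<omega>. f \<omega> * g \<omega>) = L f * L g)"

definition capacity :: "(('a \<Rightarrow> real) \<Rightarrow> real) \<Rightarrow> 'a set \<Rightarrow> real" where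
  "capacity E A = E (indicator A)"

definition polar :: "'a measure \<Rightarrow> (('a \<Rightarrow> real) \<Rightarrow> real) \<Rightarrow> 'a set \<Rightarrow> bool" where
  "polar M E A \<longleftrightarrow> A \<in> sets M \<and> capacity E A = 0"

definition quasi_surely :: "'a measure \<Rightarrow> (('a \<Rightarrow> real) \<Rightarrow> real) \<Rightarrow> ('a \<Rightarrow> bool) \<Rightarrow> bool" where
  "quasi_surely M E P \<longleftrightarrow> (\<exists>N. polar M E N \<and> (\<forall>\<omega>\<in>space M - N. P \<omega>))"

definition generated_sigma :: "'a measure \<Rightarrow> (nat \<Rightarrow> 'a \<Rightarrow> real) \<Rightarrow> nat set \<Rightarrow> 'a set set" where
  "generated_sigma M \<xi> I =
     sigma_sets (space M) (\<Union>i\<in>I. {\<xi> i -` B \<inter> space M | B. B \<in> sets borel})"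

text \<open>Sequences are indexed by \<open>i \<ge> 1\<close>; the value at index \<open>0\<close> is irrelevant.\<close>

definition independent_under ::
  "'a measure \<Rightarrow> (('a \<Rightarrow> real) \<Rightarrow> real) \<Rightarrow> (nat \<Rightarrow> 'a \<Rightarrow> real) \<Rightarrow> bool" where
  "independent_under M E \<xi> \<longleftrightarrow>
     (\<forall>i\<ge>1. \<forall>j\<ge>1. i \<noteq> j \<longrightarrow> uncorrelated M E (\<xi> i) (\<xi> j)) \<and>
     (\<forall>m\<ge>1. \<forall>n>m. \<forall>A\<in>generated_sigma M \<xi> {1..m}. \<forall>B\<in>generated_sigma M \<xi> {m+1..n}.
        capacity E (A \<inter> B) \<le> capacity E A * capacity E B)"

end

theory Submission
  imports Defs
begin

text \<open>
  The constants are \<open>\<lambda>\<^sub>i = E \<xi>\<^sub>i\<close>. Put \<open>X\<^sub>i = (\<xi>\<^sub>i - \<lambda>\<^sub>i) / i\<^sup>p\<close>. It is enough that the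
  series of the \<open>X\<^sub>i\<close> converges quasi-surely: Kronecker's lemma with the weights \<open>i\<^sup>p\<close> then
  gives the claim pathwise.

  The size of a block \<open>X\<^sub>k\<^sub>+\<^sub>1 + \<dots> + X\<^sub>n\<close> is controlled by its second moment. By a Hahn-Banach
  argument (\<open>supporting_dominated_linear\<close>) \<open>E\<close> is attained at the squared block by a dominated linear
  functional \<open>L\<close>. Under \<open>L\<close> the \<open>X\<^sub>i\<close> are pairwise uncorrelated, so the second moment is at
  most \<open>\<Sum> E X\<^sub>i\<^sup>2 + (\<Sum> L X\<^sub>i)\<^sup>2\<close>. The first sum is a block of the given convergent series. The
  means need not be zero, because different functionals may have different means, but
  \<open>-E(-\<xi>\<^sub>i) \<le> L \<xi>\<^sub>i \<le> E \<xi>\<^sub>i\<close> and the bound on \<open>E \<xi>\<^sub>i + E(-\<xi>\<^sub>i)\<close> give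
  \<open>\<bar>L X\<^sub>i\<bar> \<le> G / i\<^sup>p\<close>, which is summable since \<open>p > 1\<close>. Hence late blocks have small
  second moments, uniformly in their length.

  Passing from single blocks to their maximum is an Ottaviani argument (\<open>maximal_inequality\<close>). If some
  partial block starting at \<open>m\<close> exceeds \<open>2\<epsilon>\<close>, let \<open>A\<^sub>k\<close> be the event that this happens first at
  \<open>k\<close>; then either the full block exceeds \<open>\<epsilon>\<close>, or \<open>A\<^sub>k\<close> occurs together with a large remaining
  block after \<open>k\<close>. Independence bounds the capacity of the latter by \<open>C(A\<^sub>k) \<delta>\<close>, where
  \<open>\<delta>\<close> bounds the capacity of a late block exceeding \<open>\<epsilon>\<close>. For a probability
  the \<open>C(A\<^sub>k)\<close> would add up to at most \<open>1\<close>. For the capacity this is what the hypothesis on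
  partitions is for: it makes the total variation of \<open>C\<close> finite (\<open>finite_variation\<close>), so that
  \<open>\<Sum> C(A\<^sub>k) \<le> V\<close> with one constant \<open>V\<close> for all disjoint families. Regularity finally
  lets the block length tend to infinity, and the paths with non-vanishing tail oscillation form a
  polar set.
\<close>

section \<open>Dominated linear functionals\<close>

definition sublinear_on :: "('a \<Rightarrow> real) set \<Rightarrow> (('a \<Rightarrow> real) \<Rightarrow> real) \<Rightarrow> bool" where
  "sublinear_on X q \<longleftrightarrow>
     (\<forall>f\<in>X. \<forall>g\<in>X. q (\<lambda>\<omega>. f \<omega> + g \<omega>) \<le> q f + q g) \<and>
     (\<forall>c\<ge>0. \<forall>f\<in>X. q (\<lambda>\<omega>. c * f \<omega>) = c * q f)"

definition function_space :: "('a \<Rightarrow> real) set \<Rightarrow> bool" where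
  "function_space X \<longleftrightarrow> X \<noteq> {} \<and>
     (\<forall>f\<in>X. \<forall>g\<in>X. (\<lambda>\<omega>. f \<omega> + g \<omega>) \<in> X) \<and> (\<forall>c. \<forall>f\<in>X. (\<lambda>\<omega>. c * f \<omega>) \<in> X)"

lemma function_space_add: "function_space X \<Longrightarrow> f \<in> X \<Longrightarrow> g \<in> X \<Longrightarrow> (\<lambda>\<omega>. f \<omega> + g \<omega>) \<in> X"
  by (auto simp: function_space_def)

lemma function_space_scale: "function_space X \<Longrightarrow> f \<in> X \<Longrightarrow> (\<lambda>\<omega>. c * f \<omega>) \<in> X"
  by (auto simp: function_space_def)

lemma function_space_uminus: "function_space X \<Longrightarrow> f \<in> X \<Longrightarrow> (\<lambda>\<omega>. - f \<omega>) \<in> X"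
  using function_space_scale[of X f "-1"] by simp

lemma function_space_zero: "function_space X \<Longrightarrow> (\<lambda>\<omega>. 0) \<in> X"
  using function_space_scale[of X _ 0] by (auto simp: function_space_def)

lemma sublinear_on_add:
  "sublinear_on X q \<Longrightarrow> f \<in> X \<Longrightarrow> g \<in> X \<Longrightarrow> q (\<lambda>\<omega>. f \<omega> + g \<omega>) \<le> q f + q g"
  by (auto simp: sublinear_on_def)

lemma sublinear_on_scale:
  "sublinear_on X q \<Longrightarrow> f \<in> X \<Longrightarrow> c \<ge> 0 \<Longrightarrow> q (\<lambda>\<omega>. c * f \<omega>) = c * q f"
  by (auto simp: sublinear_on_def)

lemma sublinear_on_zero:
  assumes "function_space X" "sublinear_on X q"
  shows "q (\<lambda>\<omega>. 0) = 0"
  using sublinear_on_scale[OF assms(2) function_space_zero[OF assms(1)], of 0] by simp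

lemma sublinear_on_lower:
  assumes "function_space X" "sublinear_on X q" "f \<in> X"
  shows "- q (\<lambda>\<omega>. - f \<omega>) \<le> q f"
  using sublinear_on_add[OF assms(2,3) function_space_uminus[OF assms(1,3)]]
    sublinear_on_zero[OF assms(1,2)] by simp

text \<open>
  For positive scalars one inequality suffices, because the other one follows by scaling back with
  \<open>1 / c\<close>.
\<close>
lemma sublinear_onI:
  assumes X: "function_space X"
    and add: "\<And>f g. f \<in> X \<Longrightarrow> g \<in> X \<Longrightarrow> q (\<lambda>\<omega>. f \<omega> + g \<omega>) \<le> q f + q g"
    and zero: "q (\<lambda>\<omega>. 0) = 0"
    and scale: "\<And>f c. f \<in> X \<Longrightarrow> c > 0 \<Longrightarrow> q (\<lambda>\<omega>. c * f \<omega>) \<le> c * q f"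
  shows "sublinear_on X q"
proof -
  have "q (\<lambda>\<omega>. c * f \<omega>) = c * q f" if "c \<ge> 0" "f \<in> X" for c f
  proof (cases "c = 0")
    case True
    then show ?thesis using zero by simp
  next
    case False
    then have c: "c > 0" using that by simp
    have "q (\<lambda>\<omega>. (1 / c) * (c * f \<omega>)) \<le> (1 / c) * q (\<lambda>\<omega>. c * f \<omega>)"
      using c by (intro scale function_space_scale[OF X] that) auto
    moreover have "(\<lambda>\<omega>. (1 / c) * (c * f \<omega>)) = f"
      using c by auto
    ultimately have "c * q f \<le> q (\<lambda>\<omega>. c * f \<omega>)"
      using c by (simp add: field_simps)
    then show ?thesis using scale[OF that(2) c] by simp
  qed
  then show ?thesis using add by (auto simp: sublinear_on_def)
qed

text \<open>
  The largest sublinear functional below \<open>q\<close> whose value at \<open>- g\<close> is at most \<open>- q g\<close>. A linear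
  functional below it must therefore agree with \<open>q\<close> at \<open>g\<close>.
\<close>
definition tilt :: "(('a \<Rightarrow> real) \<Rightarrow> real) \<Rightarrow> ('a \<Rightarrow> real) \<Rightarrow> ('a \<Rightarrow> real) \<Rightarrow> real" where
  "tilt q g f = (INF t\<in>{0..}. q (\<lambda>\<omega>. f \<omega> + t * g \<omega>) - t * q g)"

lemma tilt_bdd:
  assumes "function_space X" "sublinear_on X q" "f \<in> X" "g \<in> X"
  shows "bdd_below ((\<lambda>t. q (\<lambda>\<omega>. f \<omega> + t * g \<omega>) - t * q g) ` {0..})"
proof (rule bdd_belowI2)
  fix t :: real assume "t \<in> {0..}"
  then have t: "t \<ge> 0" by simp
  have "q (\<lambda>\<omega>. (f \<omega> + t * g \<omega>) + - f \<omega>) \<le> q (\<lambda>\<omega>. f \<omega> + t * g \<omega>) + q (\<lambda>\<omega>. - f \<omega>)"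
    using assms by (intro sublinear_on_add function_space_add function_space_scale function_space_uminus)
  then show "- q (\<lambda>\<omega>. - f \<omega>) \<le> q (\<lambda>\<omega>. f \<omega> + t * g \<omega>) - t * q g"
    using sublinear_on_scale[OF assms(2,4) t] by simp
qed

lemma tilt_le:
  assumes "function_space X" "sublinear_on X q" "f \<in> X" "g \<in> X" "t \<ge> 0"
  shows "tilt q g f \<le> q (\<lambda>\<omega>. f \<omega> + t * g \<omega>) - t * q g"
  unfolding tilt_def using assms by (intro cINF_lower tilt_bdd) auto

lemma tilt_sublinear:
  assumes X: "function_space X" and q: "sublinear_on X q" and g: "g \<in> X"
  shows "sublinear_on X (tilt q g)"
proof (rule sublinear_onI[OF X])
  fix f h assume f: "f \<in> X" and h: "h \<in> X"
  have *: "tilt q g (\<lambda>\<omega>. f \<omega> + h \<omega>) \<le>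
      (q (\<lambda>\<omega>. f \<omega> + s * g \<omega>) - s * q g) + (q (\<lambda>\<omega>. h \<omega> + t * g \<omega>) - t * q g)"
    if "s \<ge> 0" "t \<ge> 0" for s t
  proof -
    have "tilt q g (\<lambda>\<omega>. f \<omega> + h \<omega>) \<le> q (\<lambda>\<omega>. (f \<omega> + h \<omega>) + (s + t) * g \<omega>) - (s + t) * q g"
      using that by (intro tilt_le[OF X q] function_space_add X f h g) auto
    also have "(\<lambda>\<omega>. (f \<omega> + h \<omega>) + (s + t) * g \<omega>) = (\<lambda>\<omega>. (f \<omega> + s * g \<omega>) + (h \<omega> + t * g \<omega>))"
      by (auto simp: algebra_simps)
    also have "q \<dots> \<le> q (\<lambda>\<omega>. f \<omega> + s * g \<omega>) + q (\<lambda>\<omega>. h \<omega> + t * g \<omega>)"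
      by (intro sublinear_on_add[OF q] function_space_add function_space_scale X f g h)
    finally show ?thesis by (simp add: algebra_simps)
  qed
  have "tilt q g (\<lambda>\<omega>. f \<omega> + h \<omega>) - (q (\<lambda>\<omega>. f \<omega> + s * g \<omega>) - s * q g) \<le> tilt q g h"
    if "s \<ge> 0" for s
    unfolding tilt_def[of q g h] using *[OF that]
    by (intro cINF_greatest) (auto simp: algebra_simps)
  then have "tilt q g (\<lambda>\<omega>. f \<omega> + h \<omega>) - tilt q g h \<le> tilt q g f"
    unfolding tilt_def[of q g f]
    by (intro cINF_greatest) (auto simp: algebra_simps)
  then show "tilt q g (\<lambda>\<omega>. f \<omega> + h \<omega>) \<le> tilt q g f + tilt q g h" by simp
next
  have "q (\<lambda>\<omega>. 0 + t * g \<omega>) - t * q g = 0" if "t \<ge> 0" for t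
    using sublinear_on_scale[OF q g that] by simp
  then have "tilt q g (\<lambda>\<omega>. 0) = (INF t\<in>{0::real..}. 0)"
    unfolding tilt_def by (intro INF_cong) auto
  then show "tilt q g (\<lambda>\<omega>. 0) = 0" by simp
next
  fix f and c :: real assume f: "f \<in> X" and c: "c > 0"
  have "tilt q g (\<lambda>\<omega>. c * f \<omega>) / c \<le> q (\<lambda>\<omega>. f \<omega> + t * g \<omega>) - t * q g" if t: "t \<ge> 0" for t
  proof -
    have "tilt q g (\<lambda>\<omega>. c * f \<omega>) \<le> q (\<lambda>\<omega>. c * f \<omega> + (c * t) * g \<omega>) - (c * t) * q g"
      using t c by (intro tilt_le[OF X q] function_space_scale X f g) auto
    also have "(\<lambda>\<omega>. c * f \<omega> + (c * t) * g \<omega>) = (\<lambda>\<omega>. c * (f \<omega> + t * g \<omega>))"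
      by (auto simp: algebra_simps)
    also have "q \<dots> = c * q (\<lambda>\<omega>. f \<omega> + t * g \<omega>)"
      using c by (intro sublinear_on_scale[OF q] function_space_add function_space_scale X f g) auto
    finally show ?thesis using c by (simp add: field_simps)
  qed
  then have "tilt q g (\<lambda>\<omega>. c * f \<omega>) / c \<le> tilt q g f"
    unfolding tilt_def[of q g f] by (intro cINF_greatest) auto
  then show "tilt q g (\<lambda>\<omega>. c * f \<omega>) \<le> c * tilt q g f"
    using c by (simp add: field_simps)
qed

text \<open>
  The infimum of a chain stays sublinear: two members are compared at once by the smaller of them.
  It is finite because \<open>q f \<ge> - q (- f) \<ge> - p (- f)\<close> for every member \<open>q\<close>.
\<close>
lemma sublinear_chain_Inf:
  assumes X: "function_space X" and ne: "C \<noteq> {}"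
    and sub: "\<And>q. q \<in> C \<Longrightarrow> sublinear_on X q"
    and dom: "\<And>q f. q \<in> C \<Longrightarrow> f \<in> X \<Longrightarrow> q f \<le> p f"
    and chain: "\<And>q r. q \<in> C \<Longrightarrow> r \<in> C \<Longrightarrow> (\<forall>f. q f \<le> r f) \<or> (\<forall>f. r f \<le> q f)"
  shows "sublinear_on X (\<lambda>f. INF q\<in>C. q f)" "\<And>f q. f \<in> X \<Longrightarrow> q \<in> C \<Longrightarrow> (INF q\<in>C. q f) \<le> q f"
proof -
  let ?u = "\<lambda>f. INF q\<in>C. q f"
  have bdd: "bdd_below ((\<lambda>q. q f) ` C)" if f: "f \<in> X" for f
  proof (rule bdd_belowI2)
    fix q assume "q \<in> C"
    then show "- p (\<lambda>\<omega>. - f \<omega>) \<le> q f"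
      using sublinear_on_lower[OF X sub f] dom[OF _ function_space_uminus[OF X f]] by fastforce
  qed
  show le: "?u f \<le> q f" if "f \<in> X" "q \<in> C" for f q
    using that by (intro cINF_lower bdd) auto
  show "sublinear_on X ?u"
  proof (rule sublinear_onI[OF X])
    fix f h assume f: "f \<in> X" and h: "h \<in> X"
    have *: "?u (\<lambda>\<omega>. f \<omega> + h \<omega>) \<le> q f + r h" if q: "q \<in> C" and r: "r \<in> C" for q r
    proof -
      obtain s where s: "s \<in> C" "\<And>f. s f \<le> q f" "\<And>f. s f \<le> r f"
        using chain[OF q r] q r by force
      have "?u (\<lambda>\<omega>. f \<omega> + h \<omega>) \<le> s (\<lambda>\<omega>. f \<omega> + h \<omega>)"
        by (intro le function_space_add X f h s)
      also have "\<dots> \<le> s f + s h" by (intro sublinear_on_add[OF sub] s f h)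
      also have "\<dots> \<le> q f + r h" by (intro add_mono s)
      finally show ?thesis .
    qed
    have "?u (\<lambda>\<omega>. f \<omega> + h \<omega>) - q f \<le> ?u h" if "q \<in> C" for q
      using *[OF that] by (intro cINF_greatest[OF ne]) (auto simp: algebra_simps)
    then have "?u (\<lambda>\<omega>. f \<omega> + h \<omega>) - ?u h \<le> ?u f"
      by (intro cINF_greatest[OF ne]) (auto simp: algebra_simps)
    then show "?u (\<lambda>\<omega>. f \<omega> + h \<omega>) \<le> ?u f + ?u h" by simp
  next
    have "?u (\<lambda>\<omega>. 0) = (INF q\<in>C. 0)"
      using sublinear_on_zero[OF X sub] by (intro INF_cong) auto
    then show "?u (\<lambda>\<omega>. 0) = 0" using ne by simp
  next
    fix f and c :: real assume f: "f \<in> X" and c: "c > 0"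
    have "?u (\<lambda>\<omega>. c * f \<omega>) / c \<le> q f" if "q \<in> C" for q
      using le[OF function_space_scale[OF X f] that, of c] sublinear_on_scale[OF sub[OF that] f, of c] c
      by (simp add: field_simps)
    then have "?u (\<lambda>\<omega>. c * f \<omega>) / c \<le> ?u f" by (intro cINF_greatest[OF ne]) auto
    then show "?u (\<lambda>\<omega>. c * f \<omega>) \<le> c * ?u f" using c by (simp add: field_simps)
  qed
qed

text \<open>
  By Zorn's lemma there is a minimal sublinear functional \<open>q\<close> below \<open>p\<close>. Tilting \<open>q\<close> at any \<open>g\<close>
  does not decrease it further, and this says that \<open>q\<close> is superadditive, hence linear.
\<close>
lemma linear_below_sublinear:
  assumes X: "function_space X" and p: "sublinear_on X p"
  obtains L where "\<And>f g. f \<in> X \<Longrightarrow> g \<in> X \<Longrightarrow> L (\<lambda>\<omega>. f \<omega> + g \<omega>) = L f + L g"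
    "\<And>c f. f \<in> X \<Longrightarrow> L (\<lambda>\<omega>. c * f \<omega>) = c * L f"
    "\<And>f. f \<in> X \<Longrightarrow> L f \<le> p f"
proof -
  \<comment> \<open>Being zero off \<open>X\<close>, these functionals are determined by \<open>X\<close>, and the pointwise order on them is antisymmetric.\<close>
  define A where "A = {q. sublinear_on X q \<and> (\<forall>f\<in>X. q f \<le> p f) \<and> (\<forall>f. f \<notin> X \<longrightarrow> q f = 0)}"
  define P :: "(('a \<Rightarrow> real) \<Rightarrow> real) \<Rightarrow> (('a \<Rightarrow> real) \<Rightarrow> real) \<Rightarrow> bool"
    where "P q r \<longleftrightarrow> (\<forall>f. r f \<le> q f)" for q r
  have zero_ext: "(\<lambda>f. if f \<in> X then q f else 0) \<in> A"
    if "sublinear_on X q" "\<And>f. f \<in> X \<Longrightarrow> q f \<le> p f" for q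
    using that function_space_add[OF X] function_space_scale[OF X]
    by (auto simp: A_def sublinear_on_def)
  have "partial_order_on A (relation_of P A)"
    by (rule partial_order_on_relation_ofI) (auto simp: P_def fun_eq_iff intro: order_trans antisym)
  moreover have "\<exists>u\<in>A. \<forall>a\<in>C. P a u" if C: "C \<in> Chains (relation_of P A)" for C
  proof (cases "C = {}")
    case True
    then show ?thesis using zero_ext[OF p] by auto
  next
    case False
    have CA: "C \<subseteq> A" using C by (auto simp: Chains_def relation_of_def)
    have C_sub: "sublinear_on X q" and C_dom: "f \<in> X \<Longrightarrow> q f \<le> p f" if "q \<in> C" for q f
      using that CA by (auto simp: A_def)
    have C_chain: "(\<forall>f. q f \<le> r f) \<or> (\<forall>f. r f \<le> q f)" if "q \<in> C" "r \<in> C" for q r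
      using that C by (auto simp: Chains_def relation_of_def P_def)
    have sub: "sublinear_on X (\<lambda>f. INF q\<in>C. q f)"
      by (rule sublinear_chain_Inf(1)[where p = p, OF X False]; rule C_sub C_dom C_chain; assumption)
    have le: "(INF q\<in>C. q f) \<le> q f" if "f \<in> X" "q \<in> C" for f q
      by (rule sublinear_chain_Inf(2)[where p = p, OF X False _ _ _ that];
          rule C_sub C_dom C_chain; assumption)
    have "(INF q\<in>C. q f) \<le> p f" if "f \<in> X" for f
      using False CA le[OF that] that by (force simp: A_def)
    then have "(\<lambda>f. if f \<in> X then INF q\<in>C. q f else 0) \<in> A" by (intro zero_ext sub)
    moreover have "P q (\<lambda>f. if f \<in> X then INF q\<in>C. q f else 0)" if "q \<in> C" for q
      using that CA le by (auto simp: P_def A_def)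
    ultimately show ?thesis by blast
  qed
  ultimately obtain q where qA: "q \<in> A" and min: "\<And>r. r \<in> A \<Longrightarrow> P q r \<Longrightarrow> r = q"
    using predicate_Zorn[of A P] by blast
  have q: "sublinear_on X q" and qp: "\<And>f. f \<in> X \<Longrightarrow> q f \<le> p f" and q0: "\<And>f. f \<notin> X \<Longrightarrow> q f = 0"
    using qA by (auto simp: A_def)
  have tilt_le_q: "tilt q g f \<le> q f" if "f \<in> X" "g \<in> X" for f g
    using tilt_le[OF X q that, of 0] by simp
  have super: "q f + q g \<le> q (\<lambda>\<omega>. f \<omega> + g \<omega>)" if f: "f \<in> X" and g: "g \<in> X" for f g
  proof -
    have "(\<lambda>f. if f \<in> X then tilt q g f else 0) \<in> A"
      using tilt_le_q[OF _ g] qp by (intro zero_ext tilt_sublinear X q g) force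
    moreover have "P q (\<lambda>f. if f \<in> X then tilt q g f else 0)"
      using tilt_le_q[OF _ g] q0 by (auto simp: P_def)
    ultimately have "(\<lambda>f. if f \<in> X then tilt q g f else 0) = q" by (rule min)
    then have "tilt q g f = q f" using f by (auto dest: fun_cong[of _ _ f])
    then show ?thesis using tilt_le[OF X q f g, of 1] by simp
  qed
  have add: "q (\<lambda>\<omega>. f \<omega> + g \<omega>) = q f + q g" if "f \<in> X" "g \<in> X" for f g
    using super[OF that] sublinear_on_add[OF q that] by simp
  have neg: "q (\<lambda>\<omega>. - f \<omega>) = - q f" if "f \<in> X" for f
    using add[OF that function_space_uminus[OF X that]] sublinear_on_zero[OF X q] by simp
  have "q (\<lambda>\<omega>. c * f \<omega>) = c * q f" if f: "f \<in> X" for c f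
  proof (cases "c \<ge> 0")
    case True
    then show ?thesis by (rule sublinear_on_scale[OF q f])
  next
    case False
    then have "q (\<lambda>\<omega>. (- c) * f \<omega>) = (- c) * q f" by (intro sublinear_on_scale[OF q f]) simp
    then show ?thesis using neg[OF function_space_scale[OF X f, of c]] by simp
  qed
  with add qp show thesis by (intro that[of q])
qed

text \<open>
  The Hahn-Banach theorem in the form needed here: a linear functional below \<open>p\<close> that touches \<open>p\<close>
  at a prescribed point. It is obtained below the tilt of \<open>p\<close> at that point.
\<close>
lemma supporting_linear_functional:
  assumes X: "function_space X" and p: "sublinear_on X p" and g: "g \<in> X"
  obtains L where "\<And>f g. f \<in> X \<Longrightarrow> g \<in> X \<Longrightarrow> L (\<lambda>\<omega>. f \<omega> + g \<omega>) = L f + L g"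
    "\<And>c f. f \<in> X \<Longrightarrow> L (\<lambda>\<omega>. c * f \<omega>) = c * L f"
    "\<And>f. f \<in> X \<Longrightarrow> L f \<le> p f" "L g = p g"
proof -
  obtain L where L: "\<And>f g. f \<in> X \<Longrightarrow> g \<in> X \<Longrightarrow> L (\<lambda>\<omega>. f \<omega> + g \<omega>) = L f + L g"
    "\<And>c f. f \<in> X \<Longrightarrow> L (\<lambda>\<omega>. c * f \<omega>) = c * L f"
    "\<And>f. f \<in> X \<Longrightarrow> L f \<le> tilt p g f"
    using linear_below_sublinear[OF X tilt_sublinear[OF X p g]] by blast
  have le: "L f \<le> p f" if "f \<in> X" for f
    using L(3)[OF that] tilt_le[OF X p that g, of 0] by simp
  have "- L g = L (\<lambda>\<omega>. - g \<omega>)" using L(2)[OF g, of "-1"] by simp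
  also have "\<dots> \<le> tilt p g (\<lambda>\<omega>. - g \<omega>)" by (intro L function_space_uminus X g)
  also have "\<dots> \<le> - p g"
    using tilt_le[OF X p function_space_uminus[OF X g] g, of 1] sublinear_on_zero[OF X p] by simp
  finally have "L g = p g" using le[OF g] by simp
  then show thesis using L le by (intro that)
qed

section \<open>Capacities of regular sublinear expectations\<close>

lemma bounded_measurable_iff:
  "f \<in> bounded_measurable M \<longleftrightarrow> f \<in> borel_measurable M \<and> (\<exists>K. \<forall>\<omega>\<in>space M. \<bar>f \<omega>\<bar> \<le> K)"
  by (auto simp: bounded_measurable_def bounded_iff)

lemma bounded_measurable_const: "(\<lambda>_. c) \<in> bounded_measurable M"
  by (auto simp: bounded_measurable_iff)

lemma bounded_measurable_indicator: "A \<in> sets M \<Longrightarrow> indicator A \<in> bounded_measurable M"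
  by (auto simp: bounded_measurable_iff indicator_def intro!: exI[of _ 1])

lemma bounded_measurable_add:
  assumes "f \<in> bounded_measurable M" "g \<in> bounded_measurable M"
  shows "(\<lambda>\<omega>. f \<omega> + g \<omega>) \<in> bounded_measurable M"
proof -
  obtain K K' where "\<forall>\<omega>\<in>space M. \<bar>f \<omega>\<bar> \<le> K" "\<forall>\<omega>\<in>space M. \<bar>g \<omega>\<bar> \<le> K'"
    using assms by (auto simp: bounded_measurable_iff)
  then have "\<forall>\<omega>\<in>space M. \<bar>f \<omega> + g \<omega>\<bar> \<le> K + K'" by force
  then show ?thesis using assms by (auto simp: bounded_measurable_iff)
qed

lemma bounded_measurable_mult:
  assumes "f \<in> bounded_measurable M" "g \<in> bounded_measurable M"
  shows "(\<lambda>\<omega>. f \<omega> * g \<omega>) \<in> bounded_measurable M"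
proof -
  obtain K K' where "\<forall>\<omega>\<in>space M. \<bar>f \<omega>\<bar> \<le> K" "\<forall>\<omega>\<in>space M. \<bar>g \<omega>\<bar> \<le> K'"
    using assms by (auto simp: bounded_measurable_iff)
  then have "\<forall>\<omega>\<in>space M. \<bar>f \<omega> * g \<omega>\<bar> \<le> K * K'"
    by (auto simp: abs_mult intro!: mult_mono intro: order_trans[OF abs_ge_zero])
  then show ?thesis using assms by (auto simp: bounded_measurable_iff)
qed

lemma bounded_measurable_scale:
  "f \<in> bounded_measurable M \<Longrightarrow> (\<lambda>\<omega>. c * f \<omega>) \<in> bounded_measurable M"
  by (intro bounded_measurable_mult bounded_measurable_const)

lemma bounded_measurable_shift:
  "f \<in> bounded_measurable M \<Longrightarrow> (\<lambda>\<omega>. f \<omega> - c) \<in> bounded_measurable M"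
  using bounded_measurable_add[OF _ bounded_measurable_const, of f M "- c"] by simp

lemma bounded_measurable_uminus:
  "f \<in> bounded_measurable M \<Longrightarrow> (\<lambda>\<omega>. - f \<omega>) \<in> bounded_measurable M"
  using bounded_measurable_scale[of f M "-1"] by simp

lemma bounded_measurable_power2:
  "f \<in> bounded_measurable M \<Longrightarrow> (\<lambda>\<omega>. (f \<omega>)\<^sup>2) \<in> bounded_measurable M"
  unfolding power2_eq_square by (rule bounded_measurable_mult)

lemma bounded_measurable_sum:
  "(\<And>i. i \<in> I \<Longrightarrow> f i \<in> bounded_measurable M) \<Longrightarrow> (\<lambda>\<omega>. \<Sum>i\<in>I. f i \<omega>) \<in> bounded_measurable M"
  by (induction I rule: infinite_finite_induct)
    (auto intro: bounded_measurable_const bounded_measurable_add)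

lemma function_space_bounded_measurable: "function_space (bounded_measurable M)"
  unfolding function_space_def
  using bounded_measurable_add bounded_measurable_scale bounded_measurable_const by blast

lemma dominated_linear_sum:
  assumes L: "L \<in> dominated_linear M E" and "\<And>i. i \<in> I \<Longrightarrow> f i \<in> bounded_measurable M"
  shows "L (\<lambda>\<omega>. \<Sum>i\<in>I. f i \<omega>) = (\<Sum>i\<in>I. L (f i))"
proof -
  have L0: "L (\<lambda>\<omega>. 0) = 0"
    using L bounded_measurable_const[of 0 M] by (force simp: dominated_linear_def)
  show ?thesis using assms(2)
  proof (induction I rule: infinite_finite_induct)
    case (insert i I)
    have "L (\<lambda>\<omega>. f i \<omega> + (\<Sum>i\<in>I. f i \<omega>)) = L (f i) + L (\<lambda>\<omega>. \<Sum>i\<in>I. f i \<omega>)"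
      using L insert.prems bounded_measurable_sum[of I f M] by (auto simp: dominated_linear_def)
    then show ?case using insert by simp
  qed (simp_all add: L0)
qed

locale regular_sublinear =
  fixes M :: "'a measure" and E :: "('a \<Rightarrow> real) \<Rightarrow> real"
  assumes sublinear: "sublinear_expectation M E"
    and regular: "regular_expectation M E"
begin

abbreviation "C \<equiv> capacity E"

lemma mono: "f \<in> bounded_measurable M \<Longrightarrow> g \<in> bounded_measurable M \<Longrightarrow>
    (\<And>\<omega>. \<omega> \<in> space M \<Longrightarrow> f \<omega> \<le> g \<omega>) \<Longrightarrow> E f \<le> E g"
  using sublinear by (auto simp: sublinear_expectation_def)

lemma const: "E (\<lambda>_. c) = c"
  using sublinear by (auto simp: sublinear_expectation_def)

lemma scale: "f \<in> bounded_measurable M \<Longrightarrow> c \<ge> 0 \<Longrightarrow> E (\<lambda>\<omega>. c * f \<omega>) = c * E f"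
  using sublinear by (auto simp: sublinear_expectation_def)

lemma sublinear_on_E: "sublinear_on (bounded_measurable M) E"
  using sublinear by (auto simp: sublinear_expectation_def sublinear_on_def)

lemma capacity_empty: "C {} = 0"
proof -
  have "indicator {} = (\<lambda>_::'a. 0::real)" by (auto simp: indicator_def)
  then show ?thesis using const[of 0] by (simp add: capacity_def)
qed

lemma capacity_mono: "A \<in> sets M \<Longrightarrow> B \<in> sets M \<Longrightarrow> A \<subseteq> B \<Longrightarrow> C A \<le> C B"
  unfolding capacity_def by (intro mono bounded_measurable_indicator) (auto simp: indicator_def)

lemma capacity_nonneg: "A \<in> sets M \<Longrightarrow> 0 \<le> C A"
  using capacity_mono[of "{}" A] capacity_empty by simp

lemma capacity_le_one: "A \<in> sets M \<Longrightarrow> C A \<le> 1"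
  using mono[OF bounded_measurable_indicator bounded_measurable_const, of A 1] const[of 1]
  by (auto simp: capacity_def indicator_def)

lemma capacity_subadditive:
  assumes "A \<in> sets M" "B \<in> sets M"
  shows "C (A \<union> B) \<le> C A + C B"
proof -
  have "C (A \<union> B) \<le> E (\<lambda>\<omega>. indicator A \<omega> + indicator B \<omega>)"
    unfolding capacity_def using assms
    by (intro mono bounded_measurable_add bounded_measurable_indicator) (auto simp: indicator_def)
  also have "\<dots> \<le> C A + C B"
    unfolding capacity_def using assms
    by (intro sublinear_on_add[OF sublinear_on_E] bounded_measurable_indicator)
  finally show ?thesis .
qed

lemma capacity_finite_subadditive:
  assumes "finite I" "\<And>i. i \<in> I \<Longrightarrow> A i \<in> sets M"
  shows "C (\<Union>i\<in>I. A i) \<le> (\<Sum>i\<in>I. C (A i))"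
  using assms
proof (induction I rule: finite_induct)
  case (insert i I)
  have "C (A i \<union> (\<Union>i\<in>I. A i)) \<le> C (A i) + C (\<Union>i\<in>I. A i)"
    using insert by (intro capacity_subadditive sets.finite_UN) auto
  then show ?case using insert by simp
qed (simp add: capacity_empty)

text \<open>
  Continuity from below. Regularity is continuity at \<open>0\<close>, applied here to the indicators of the
  remainders, which decrease to \<open>0\<close>; subadditivity does the rest.
\<close>
lemma capacity_incseq_le:
  assumes A: "range A \<subseteq> sets M" and inc: "incseq A" and le: "\<And>n. C (A n) \<le> K"
  shows "C (\<Union>n. A n) \<le> K"
proof -
  let ?D = "\<lambda>n. (\<Union>n. A n) - A n"
  have meas: "?D n \<in> sets M" "A n \<in> sets M" for n using A by auto
  have "(\<lambda>n. indicator (?D n) \<omega> :: real) \<longlonglongrightarrow> 0" for \<omega>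
  proof (cases "\<omega> \<in> (\<Union>n. A n)")
    case True
    then obtain m where "\<omega> \<in> A m" by auto
    then have "\<omega> \<in> A n" if "n \<ge> m" for n using inc that by (auto simp: incseq_def)
    then show ?thesis
      by (intro tendsto_eventually) (auto simp: eventually_sequentially indicator_def)
  qed (auto simp: indicator_def)
  moreover have "decseq (\<lambda>n. indicator (?D n) \<omega> :: real)" for \<omega>
    using inc by (auto simp: decseq_def incseq_def indicator_def)
  ultimately have "decseq (\<lambda>n. E (indicator (?D n))) \<and> (\<lambda>n. E (indicator (?D n))) \<longlonglongrightarrow> 0"
    using bounded_measurable_indicator[OF meas(1)]
    by (intro regular[unfolded regular_expectation_def, rule_format]) auto
  then have lim: "(\<lambda>n. C (?D n)) \<longlonglongrightarrow> 0" by (simp add: capacity_def)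
  have "C (\<Union>n. A n) \<le> K + C (?D n)" for n
  proof -
    have "C (\<Union>n. A n) = C (A n \<union> ?D n)" by (rule arg_cong[of _ _ C]) auto
    also have "\<dots> \<le> C (A n) + C (?D n)" by (rule capacity_subadditive[OF meas(2,1)])
    finally show ?thesis using le[of n] by linarith
  qed
  then show ?thesis
    using LIMSEQ_le_const[OF tendsto_add[OF tendsto_const[of K] lim]] by auto
qed

lemma capacity_null_UN:
  assumes A: "\<And>n::nat. A n \<in> sets M" and null: "\<And>n. C (A n) = 0"
  shows "C (\<Union>n. A n) = 0"
proof -
  have "C (\<Union>n. \<Union>i\<le>n. A i) \<le> 0"
  proof (rule capacity_incseq_le)
    show "C (\<Union>i\<le>n. A i) \<le> 0" for n
      using capacity_finite_subadditive[of "{..n}" A] A null by simp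
    show "incseq (\<lambda>n. \<Union>i\<le>n. A i)" by (force simp: incseq_def)
  qed (use A in auto)
  moreover have "(\<Union>n. \<Union>i\<le>n. A i) = (\<Union>n. A n)" by auto
  moreover have "0 \<le> C (\<Union>n. A n)" using A by (intro capacity_nonneg) auto
  ultimately show ?thesis by simp
qed

lemma chebyshev:
  assumes f: "f \<in> bounded_measurable M" and e: "\<epsilon> > 0"
  shows "C {\<omega>\<in>space M. \<bar>f \<omega>\<bar> > \<epsilon>} \<le> E (\<lambda>\<omega>. (f \<omega>)\<^sup>2) / \<epsilon>\<^sup>2"
proof -
  have [measurable]: "f \<in> borel_measurable M" using f by (auto simp: bounded_measurable_iff)
  have "C {\<omega>\<in>space M. \<bar>f \<omega>\<bar> > \<epsilon>} \<le> E (\<lambda>\<omega>. (1 / \<epsilon>\<^sup>2) * (f \<omega>)\<^sup>2)"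
    unfolding capacity_def
  proof (rule mono)
    fix \<omega> assume "\<omega> \<in> space M"
    have "1 \<le> (1 / \<epsilon>\<^sup>2) * (f \<omega>)\<^sup>2" if "\<bar>f \<omega>\<bar> > \<epsilon>"
      using that e power_mono[of \<epsilon> "\<bar>f \<omega>\<bar>" 2] by (simp add: field_simps)
    then show "indicator {\<omega>\<in>space M. \<bar>f \<omega>\<bar> > \<epsilon>} \<omega> \<le> (1 / \<epsilon>\<^sup>2) * (f \<omega>)\<^sup>2"
      by (auto simp: indicator_def)
  next
    show "(\<lambda>\<omega>. (1 / \<epsilon>\<^sup>2) * (f \<omega>)\<^sup>2) \<in> bounded_measurable M"
      by (intro bounded_measurable_scale bounded_measurable_power2 f)
  qed (auto intro!: bounded_measurable_indicator)
  also have "\<dots> = E (\<lambda>\<omega>. (f \<omega>)\<^sup>2) / \<epsilon>\<^sup>2"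
    by (subst scale) (auto intro!: bounded_measurable_power2 f)
  finally show ?thesis .
qed

text \<open>
  The sublinear expectation is a supremum of linear ones and the supremum is attained, so that an
  estimate for all dominated functionals carries over to \<open>E\<close>.
\<close>
lemma supporting_dominated_linear:
  assumes "f \<in> bounded_measurable M"
  obtains L where "L \<in> dominated_linear M E" "L f = E f"
proof -
  show thesis
  proof (rule supporting_linear_functional[OF function_space_bounded_measurable sublinear_on_E assms])
    fix L assume "\<And>f g. f \<in> bounded_measurable M \<Longrightarrow> g \<in> bounded_measurable M \<Longrightarrow>
        L (\<lambda>\<omega>. f \<omega> + g \<omega>) = L f + L g"
      "\<And>c f. f \<in> bounded_measurable M \<Longrightarrow> L (\<lambda>\<omega>. c * f \<omega>) = c * L f"
      "\<And>f. f \<in> bounded_measurable M \<Longrightarrow> L f \<le> E f" "L f = E f"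
    then show thesis by (intro that[of L]) (auto simp: dominated_linear_def)
  qed
qed

end

section \<open>Finite variation\<close>

context regular_sublinear
begin

text \<open>
  Finiteness of the total variation of \<open>C\<close> on \<open>A\<close>. Intersecting sequences with \<open>A\<close>, instead of
  requiring subsets of \<open>A\<close>, makes restriction to a smaller set immediate.
\<close>
definition finite_variation_on :: "'a set \<Rightarrow> bool" where
  "finite_variation_on A \<longleftrightarrow>
     (\<exists>K. \<forall>D n. range D \<subseteq> sets M \<longrightarrow> disjoint_family D \<longrightarrow> (\<Sum>i<n::nat. C (D i \<inter> A)) \<le> K)"

lemma finite_variation_on_UN:
  assumes I: "finite I" and A: "A \<in> sets M" "A \<subseteq> (\<Union>i\<in>I. P i)"
    and P: "\<And>i. i \<in> I \<Longrightarrow> P i \<in> sets M" "\<And>i. i \<in> I \<Longrightarrow> finite_variation_on (P i)"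
  shows "finite_variation_on A"
proof -
  obtain K where K: "\<And>i D n. i \<in> I \<Longrightarrow> range D \<subseteq> sets M \<Longrightarrow> disjoint_family D \<Longrightarrow>
      (\<Sum>k<n::nat. C (D k \<inter> P i)) \<le> K i"
    using P(2) unfolding finite_variation_on_def by metis
  have "(\<Sum>k<n. C (D k \<inter> A)) \<le> (\<Sum>i\<in>I. K i)"
    if D: "range D \<subseteq> sets M" "disjoint_family D" for D :: "nat \<Rightarrow> 'a set" and n
  proof -
    have Dm: "D k \<in> sets M" for k using D by auto
    have "C (D k \<inter> A) \<le> (\<Sum>i\<in>I. C (D k \<inter> P i))" for k
    proof -
      have "C (D k \<inter> A) \<le> C (\<Union>i\<in>I. D k \<inter> P i)"
        using A P I Dm by (intro capacity_mono) (auto intro!: sets.finite_UN)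
      also have "\<dots> \<le> (\<Sum>i\<in>I. C (D k \<inter> P i))"
        using P Dm by (intro capacity_finite_subadditive I) auto
      finally show ?thesis .
    qed
    then have "(\<Sum>k<n. C (D k \<inter> A)) \<le> (\<Sum>k<n. \<Sum>i\<in>I. C (D k \<inter> P i))"
      by (intro sum_mono)
    also have "\<dots> = (\<Sum>i\<in>I. \<Sum>k<n. C (D k \<inter> P i))" by (rule sum.swap)
    also have "\<dots> \<le> (\<Sum>i\<in>I. K i)" using K D by (intro sum_mono) auto
    finally show ?thesis .
  qed
  then show ?thesis unfolding finite_variation_on_def by blast
qed

text \<open>
  A set of infinite variation carries disjoint sets whose capacities sum to more than \<open>2\<close>. One of
  these sets, or the remainder, again has infinite variation. Discarding it costs at most \<open>1\<close>, since
  \<open>C \<le> 1\<close>, so what is left still has total capacity at least \<open>1\<close>.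
\<close>
lemma infinite_variation_split:
  assumes A: "A \<in> sets M" and inf: "\<not> finite_variation_on A"
  obtains A' D n where "A' \<in> sets M" "\<not> finite_variation_on A'" "A' \<subseteq> A"
    "range D \<subseteq> sets M" "disjoint_family D" "\<And>i. D i \<subseteq> A - A'" "(\<Sum>i<n::nat. C (D i)) \<ge> 1"
proof -
  obtain D n where D: "range D \<subseteq> sets M" "disjoint_family D" "(\<Sum>i<n::nat. C (D i \<inter> A)) > 2"
    using inf unfolding finite_variation_on_def by (metis not_le)
  have Dm: "D k \<in> sets M" for k using D by auto
  define P where "P i = (if i < n then D i \<inter> A else A - (\<Union>k<n. D k))" for i
  have Pm: "P i \<in> sets M" for i using A Dm by (auto simp: P_def)
  have "A \<subseteq> (\<Union>i\<in>{..n}. P i)"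
  proof
    fix \<omega> assume w: "\<omega> \<in> A"
    show "\<omega> \<in> (\<Union>i\<in>{..n}. P i)"
    proof (cases "\<exists>k<n. \<omega> \<in> D k")
      case True
      then show ?thesis using w by (force simp: P_def)
    next
      case False
      then have "\<omega> \<in> P n" using w by (auto simp: P_def)
      then show ?thesis by blast
    qed
  qed
  then obtain j where j: "\<not> finite_variation_on (P j)"
    using finite_variation_on_UN[of "{..n}" A P] A Pm inf by blast
  define D' where "D' i = D i \<inter> A - P j" for i
  have D'm: "D' i \<in> sets M" for i using Dm A Pm by (auto simp: D'_def)
  have le: "C (D i \<inter> A) \<le> C (D' i) + (if i = j then 1 else 0)" if "i < n" for i
  proof (cases "i = j")
    case True
    then show ?thesis using capacity_le_one[of "D i \<inter> A"] capacity_nonneg[OF D'm[of i]] Dm A by auto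
  next
    case False
    then have "D i \<inter> A \<inter> P j = {}"
      using D(2) that by (auto simp: P_def disjoint_family_on_def)
    then have "D' i = D i \<inter> A" by (auto simp: D'_def)
    then show ?thesis using False by simp
  qed
  have "2 < (\<Sum>i<n. C (D' i) + (if i = j then 1 else 0))"
    using D(3) le by (intro less_le_trans[OF D(3)] sum_mono) auto
  also have "\<dots> \<le> (\<Sum>i<n. C (D' i)) + 1"
    by (simp add: sum.distrib sum.delta')
  finally have "(\<Sum>i<n. C (D' i)) \<ge> 1" by simp
  moreover have "disjoint_family D'"
    using D(2) by (auto simp: disjoint_family_on_def D'_def)
  ultimately show thesis using j Pm D'm
    by (intro that[of "P j" D' n]) (auto simp: D'_def P_def)
qed

text \<open>
  Bounds for the individual partitions imply a bound common to all of them. Otherwise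
  the splitting can be iterated on the part of infinite variation, and all the pieces split off
  form one countable disjoint family whose capacities have infinite sum.
\<close>
lemma finite_variation:
  assumes partition: "\<And>A :: nat \<Rightarrow> 'a set. range A \<subseteq> sets M \<Longrightarrow> (\<Union>n. A n) = space M \<Longrightarrow>
      disjoint_family A \<Longrightarrow> summable (\<lambda>n. C (A n))"
  obtains V where "\<And>D n. range D \<subseteq> sets M \<Longrightarrow> disjoint_family D \<Longrightarrow> (\<Sum>i<n::nat. C (D i)) \<le> V"
proof -
  have "finite_variation_on (space M)"
  proof (rule ccontr)
    assume inf: "\<not> finite_variation_on (space M)"
    have "\<exists>A' D n. A' \<in> sets M \<and> \<not> finite_variation_on A' \<and> A' \<subseteq> A \<and>
        range D \<subseteq> sets M \<and> disjoint_family D \<and> (\<forall>i. D i \<subseteq> A - A') \<and> (\<Sum>i<n::nat. C (D i)) \<ge> 1"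
      if "A \<in> sets M \<and> \<not> finite_variation_on A" for A
      using infinite_variation_split[of A] that by metis
    then obtain nxt D n where step: "\<And>A. A \<in> sets M \<and> \<not> finite_variation_on A \<Longrightarrow>
        nxt A \<in> sets M \<and> \<not> finite_variation_on (nxt A) \<and> nxt A \<subseteq> A \<and>
        range (D A) \<subseteq> sets M \<and> disjoint_family (D A) \<and> (\<forall>i. D A i \<subseteq> A - nxt A) \<and>
        (\<Sum>i<n A::nat. C (D A i)) \<ge> 1"
      by metis
    define R where "R j = (nxt ^^ j) (space M)" for j
    have R: "R j \<in> sets M \<and> \<not> finite_variation_on (R j)" for j
      by (induction j) (use inf step in \<open>auto simp: R_def\<close>)
    have R_Suc: "R (Suc j) = nxt (R j)" for j by (simp add: R_def)
    note stepR = step[OF R, folded R_Suc]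
    have "decseq R" using stepR by (intro decseq_SucI) blast
    then have R_mono: "R k \<subseteq> R j" if "j \<le> k" for j k
      using that by (auto simp: decseq_def)
    \<comment> \<open>The pieces of all stages, enumerated as a single sequence.\<close>
    define G where "G k = (case prod_decode k of (j, i) \<Rightarrow> D (R j) i)" for k
    have G_enc: "G (prod_encode (j, i)) = D (R j) i" for i j by (simp add: G_def)
    have "D (R j) i \<in> sets M" for j i using stepR[of j] by blast
    then have Gm: "G k \<in> sets M" for k by (auto simp: G_def split: prod.split)
    have disj_lt: "D (R j) i \<inter> D (R j') i' = {}" if "j < j'" for j j' i i'
      using stepR[of j] stepR[of j'] R_mono[of "Suc j" j'] that by (auto; blast)
    have disj: "D (R j) i \<inter> D (R j') i' = {}" if "(j, i) \<noteq> (j', i')" for j j' i i'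
    proof (cases "j = j'")
      case True
      then show ?thesis using stepR[of j] that by (auto simp: disjoint_family_on_def)
    next
      case False
      then show ?thesis using disj_lt[of j j'] disj_lt[of j' j] by (metis Int_commute nat_neq_iff)
    qed
    have G_disj: "G k \<inter> G l = {}" if "k \<noteq> l" for k l
    proof -
      obtain j i j' i' where kl: "k = prod_encode (j, i)" "l = prod_encode (j', i')"
        by (metis prod_decode_inverse surj_pair)
      then have "(j, i) \<noteq> (j', i')" using that by auto
      then show ?thesis unfolding kl G_enc by (rule disj)
    qed
    \<comment> \<open>Adding the uncovered remainder as the first member yields a partition of the whole space.\<close>
    define H where "H = case_nat (space M - (\<Union>k. G k)) G"
    have "summable (\<lambda>k. C (H k))"
    proof (rule partition)
      show "range H \<subseteq> sets M" using Gm by (auto simp: H_def split: nat.split)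
      show "(\<Union>k. H k) = space M"
      proof -
        have "(\<Union>k. H k) = H 0 \<union> (\<Union>k. H (Suc k))" by (metis UNIV_nat_eq UN_insert image_image)
        also have "\<dots> = space M" using sets.sets_into_space[OF Gm] by (auto simp: H_def)
        finally show ?thesis .
      qed
      show "disjoint_family H"
        using G_disj by (auto simp: H_def disjoint_family_on_def split: nat.split)
    qed
    then have sumG: "summable (\<lambda>k. C (G k))"
      by (subst (asm) summable_Suc_iff[symmetric]) (simp add: H_def)
    have "real J \<le> (\<Sum>k. C (G k))" for J
    proof -
      let ?S = "Sigma {..<J} (\<lambda>j. {..<n (R j)})"
      have "real J = (\<Sum>j<J. 1)" by simp
      also have "\<dots> \<le> (\<Sum>j<J. \<Sum>i<n (R j). C (D (R j) i))"
        using stepR by (intro sum_mono) blast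
      also have "\<dots> = (\<Sum>(j, i)\<in>?S. C (D (R j) i))" by (intro sum.Sigma) auto
      also have "\<dots> = (\<Sum>x\<in>?S. C (G (prod_encode x)))"
        by (intro sum.cong) (auto simp: G_enc)
      also have "\<dots> = (\<Sum>k\<in>prod_encode ` ?S. C (G k))"
        by (subst sum.reindex) (auto intro: inj_on_subset[OF inj_prod_encode])
      also have "\<dots> \<le> (\<Sum>k. C (G k))"
        by (intro sum_le_suminf sumG) (auto intro: capacity_nonneg Gm)
      finally show ?thesis .
    qed
    then show False by (meson not_le reals_Archimedean2)
  qed
  then obtain V where V: "\<And>D n. range D \<subseteq> sets M \<Longrightarrow> disjoint_family D \<Longrightarrow>
      (\<Sum>i<n::nat. C (D i \<inter> space M)) \<le> V"
    unfolding finite_variation_on_def by blast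
  show thesis
  proof (rule that)
    fix D :: "nat \<Rightarrow> 'a set" and n assume D: "range D \<subseteq> sets M" "disjoint_family D"
    have "D i \<inter> space M = D i" for i using D(1) sets.sets_into_space by blast
    then show "(\<Sum>i<n. C (D i)) \<le> V" using V[OF D, of n] by simp
  qed
qed

end

section \<open>Independent sequences\<close>

text \<open>
  The family \<open>generated_sigma\<close> as a measurable space, so that measurability of compound expressions
  in the \<open>\<xi> i\<close> shows that events belong to it.
\<close>
definition generated_space :: "'a measure \<Rightarrow> (nat \<Rightarrow> 'a \<Rightarrow> real) \<Rightarrow> nat set \<Rightarrow> 'a measure" where
  "generated_space M \<xi> I = sigma (space M) (\<Union>i\<in>I. {\<xi> i -` B \<inter> space M | B. B \<in> sets borel})"

lemma space_generated_space: "space (generated_space M \<xi> I) = space M"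
  by (auto simp: generated_space_def space_measure_of_conv)

lemma sets_generated_space: "sets (generated_space M \<xi> I) = generated_sigma M \<xi> I"
  unfolding generated_space_def generated_sigma_def by (rule sets_measure_of) auto

lemma measurable_generated_space:
  assumes "i \<in> I"
  shows "\<xi> i \<in> borel_measurable (generated_space M \<xi> I)"
proof (rule measurableI)
  fix B :: "real set" assume "B \<in> sets borel"
  then show "\<xi> i -` B \<inter> space (generated_space M \<xi> I) \<in> sets (generated_space M \<xi> I)"
    unfolding space_generated_space unfolding sets_generated_space generated_sigma_def
    using assms by (intro sigma_sets.Basic) auto
qed simp

lemma generated_sigma_subset:
  assumes "space N = space M" "\<And>i. i \<in> I \<Longrightarrow> X i \<in> borel_measurable N"
  shows "generated_sigma M X I \<subseteq> sets N"
  unfolding generated_sigma_def assms(1)[symmetric]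
  using measurable_sets[OF assms(2)] by (intro sets.sigma_sets_subset) auto

lemma dominated_linear_const:
  assumes E: "sublinear_expectation M E" and L: "L \<in> dominated_linear M E"
  shows "L (\<lambda>_. c) = c"
proof -
  have le: "L (\<lambda>_. c) \<le> c" for c
    using E L bounded_measurable_const[of c M]
    by (force simp: dominated_linear_def sublinear_expectation_def)
  have "L (\<lambda>_. - c) = - L (\<lambda>_. c)"
    using L bounded_measurable_const[of c M] by (force simp: dominated_linear_def dest: spec[of _ "-1"])
  then show ?thesis using le[of c] le[of "- c"] by simp
qed

lemma uncorrelated_affine:
  assumes E: "sublinear_expectation M E"
    and f: "f \<in> bounded_measurable M" and g: "g \<in> bounded_measurable M"
    and fg: "uncorrelated M E f g"
  shows "uncorrelated M E (\<lambda>\<omega>. a * (f \<omega> - c)) (\<lambda>\<omega>. b * (g \<omega> - d))"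
  unfolding uncorrelated_def
proof
  fix L assume L: "L \<in> dominated_linear M E"
  have add: "L (\<lambda>\<omega>. u \<omega> + v \<omega>) = L u + L v"
    if "u \<in> bounded_measurable M" "v \<in> bounded_measurable M" for u v
    using L that by (auto simp: dominated_linear_def)
  have scale: "L (\<lambda>\<omega>. t * u \<omega>) = t * L u" if "u \<in> bounded_measurable M" for u t
    using L that by (auto simp: dominated_linear_def)
  have shift: "L (\<lambda>\<omega>. u \<omega> - t) = L u - t" if "u \<in> bounded_measurable M" for u t
    using add[OF that bounded_measurable_const[of "- t"]] dominated_linear_const[OF E L, of "- t"] by simp
  have "L (\<lambda>\<omega>. (f \<omega> - c) * (g \<omega> - d)) =
      L (\<lambda>\<omega>. f \<omega> * g \<omega> + (- c * (g \<omega> - d) + - d * f \<omega>))"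
    by (intro arg_cong[of _ _ L]) (auto simp: algebra_simps)
  also have "\<dots> = L f * L g + (- c * (L g - d) + - d * L f)"
  proof -
    have b: "(\<lambda>\<omega>. - c * (g \<omega> - d)) \<in> bounded_measurable M" "(\<lambda>\<omega>. - d * f \<omega>) \<in> bounded_measurable M"
      by (intro bounded_measurable_scale bounded_measurable_shift f g)+
    have "L (\<lambda>\<omega>. f \<omega> * g \<omega> + (- c * (g \<omega> - d) + - d * f \<omega>)) =
        L (\<lambda>\<omega>. f \<omega> * g \<omega>) + (L (\<lambda>\<omega>. - c * (g \<omega> - d)) + L (\<lambda>\<omega>. - d * f \<omega>))"
      by (simp only: add[OF bounded_measurable_mult[OF f g] bounded_measurable_add[OF b]] add[OF b])
    also have "L (\<lambda>\<omega>. - c * (g \<omega> - d)) = - c * (L g - d)"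
      by (simp only: scale[OF bounded_measurable_shift[OF g]] shift[OF g])
    also have "L (\<lambda>\<omega>. - d * f \<omega>) = - d * L f" by (rule scale[OF f])
    also have "L (\<lambda>\<omega>. f \<omega> * g \<omega>) = L f * L g" using fg L by (simp add: uncorrelated_def)
    finally show ?thesis .
  qed
  finally have prod: "L (\<lambda>\<omega>. (f \<omega> - c) * (g \<omega> - d)) = (L f - c) * (L g - d)"
    by (simp add: algebra_simps)
  have "L (\<lambda>\<omega>. a * (f \<omega> - c) * (b * (g \<omega> - d))) = L (\<lambda>\<omega>. (a * b) * ((f \<omega> - c) * (g \<omega> - d)))"
    by (intro arg_cong[of _ _ L]) (auto simp: algebra_simps)
  also have "\<dots> = (a * b) * ((L f - c) * (L g - d))"
    using f g by (subst scale) (auto intro!: bounded_measurable_mult bounded_measurable_shift simp: prod)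
  also have "\<dots> = L (\<lambda>\<omega>. a * (f \<omega> - c)) * L (\<lambda>\<omega>. b * (g \<omega> - d))"
    using f g by (simp add: scale shift bounded_measurable_shift)
  finally show "L (\<lambda>\<omega>. a * (f \<omega> - c) * (b * (g \<omega> - d))) =
      L (\<lambda>\<omega>. a * (f \<omega> - c)) * L (\<lambda>\<omega>. b * (g \<omega> - d))" .
qed

text \<open>
  Independence is invariant under affine maps because \<open>L c = c\<close> for dominated \<open>L\<close>, so that
  covariances are bilinear, and because the transformed variables generate no new events.
\<close>
lemma independent_under_affine:
  assumes E: "sublinear_expectation M E" and indep: "independent_under M E \<xi>"
    and \<xi>: "\<And>i. i \<ge> 1 \<Longrightarrow> \<xi> i \<in> bounded_measurable M"
  shows "independent_under M E (\<lambda>i \<omega>. a i * (\<xi> i \<omega> - l i))"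
proof -
  let ?X = "\<lambda>i \<omega>. a i * (\<xi> i \<omega> - l i)"
  have sub: "generated_sigma M ?X I \<subseteq> generated_sigma M \<xi> I" for I
    unfolding sets_generated_space[of M \<xi> I, symmetric]
  proof (rule generated_sigma_subset)
    fix i assume "i \<in> I"
    then have [measurable]: "\<xi> i \<in> borel_measurable (generated_space M \<xi> I)"
      by (rule measurable_generated_space)
    show "?X i \<in> borel_measurable (generated_space M \<xi> I)" by measurable
  qed (rule space_generated_space)
  show ?thesis
    unfolding independent_under_def
  proof (intro conjI allI impI ballI)
    fix i j :: nat assume "1 \<le> i" "1 \<le> j" "i \<noteq> j"
    then show "uncorrelated M E (\<lambda>\<omega>. a i * (\<xi> i \<omega> - l i)) (\<lambda>\<omega>. a j * (\<xi> j \<omega> - l j))"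
      using indep unfolding independent_under_def by (intro uncorrelated_affine E \<xi>) simp_all
  next
    fix m n :: nat and A B assume mn: "1 \<le> m" "m < n"
      and A: "A \<in> generated_sigma M (\<lambda>i \<omega>. a i * (\<xi> i \<omega> - l i)) {1..m}"
      and B: "B \<in> generated_sigma M (\<lambda>i \<omega>. a i * (\<xi> i \<omega> - l i)) {m+1..n}"
    have "A \<in> generated_sigma M \<xi> {1..m}" "B \<in> generated_sigma M \<xi> {m+1..n}"
      by (rule subsetD[OF sub A], rule subsetD[OF sub B])
    then show "capacity E (A \<inter> B) \<le> capacity E A * capacity E B"
      using indep mn unfolding independent_under_def by simp
  qed
qed

section \<open>Maximal inequality and convergence of series\<close>

context regular_sublinear
begin

text \<open>
  Expanding the square under a functional \<open>L\<close> at which \<open>E\<close> is attained leaves, besides the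
  diagonal, only products of means. The means enter through the bounds \<open>b\<close>, since
  one centring cannot in general make the means vanish for every dominated functional at once.
\<close>
lemma second_moment_sum:
  assumes I: "finite I" and X: "\<And>i. i \<in> I \<Longrightarrow> X i \<in> bounded_measurable M"
    and uncor: "\<And>i j. i \<in> I \<Longrightarrow> j \<in> I \<Longrightarrow> i \<noteq> j \<Longrightarrow> uncorrelated M E (X i) (X j)"
    and mean: "\<And>i. i \<in> I \<Longrightarrow> \<forall>L\<in>dominated_linear M E. \<bar>L (X i)\<bar> \<le> b i"
  shows "E (\<lambda>\<omega>. (\<Sum>i\<in>I. X i \<omega>)\<^sup>2) \<le> (\<Sum>i\<in>I. E (\<lambda>\<omega>. (X i \<omega>)\<^sup>2)) + (\<Sum>i\<in>I. b i)\<^sup>2"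
proof -
  obtain L where L: "L \<in> dominated_linear M E"
    and LE: "L (\<lambda>\<omega>. (\<Sum>i\<in>I. X i \<omega>)\<^sup>2) = E (\<lambda>\<omega>. (\<Sum>i\<in>I. X i \<omega>)\<^sup>2)"
    by (rule supporting_dominated_linear[of "\<lambda>\<omega>. (\<Sum>i\<in>I. X i \<omega>)\<^sup>2"])
      (intro bounded_measurable_power2 bounded_measurable_sum X)
  have le: "L f \<le> E f" if "f \<in> bounded_measurable M" for f
    using L that by (auto simp: dominated_linear_def)
  have "L (\<lambda>\<omega>. (\<Sum>i\<in>I. X i \<omega>)\<^sup>2) = L (\<lambda>\<omega>. \<Sum>i\<in>I. \<Sum>j\<in>I. X i \<omega> * X j \<omega>)"
    by (simp add: power2_eq_square sum_product)
  also have "\<dots> = (\<Sum>i\<in>I. \<Sum>j\<in>I. L (\<lambda>\<omega>. X i \<omega> * X j \<omega>))"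
    using X by (simp add: dominated_linear_sum[OF L] bounded_measurable_sum bounded_measurable_mult)
  also have "\<dots> \<le> (\<Sum>i\<in>I. \<Sum>j\<in>I. (if i = j then E (\<lambda>\<omega>. (X i \<omega>)\<^sup>2) else 0) + L (X i) * L (X j))"
  proof (intro sum_mono)
    fix i j assume ij: "i \<in> I" "j \<in> I"
    show "L (\<lambda>\<omega>. X i \<omega> * X j \<omega>) \<le> (if i = j then E (\<lambda>\<omega>. (X i \<omega>)\<^sup>2) else 0) + L (X i) * L (X j)"
    proof (cases "i = j")
      case True
      then show ?thesis using le[OF bounded_measurable_power2[OF X[OF ij(1)]]]
        by (auto simp: power2_eq_square intro: add_increasing2)
    next
      case False
      then show ?thesis using uncor[OF ij] L by (auto simp: uncorrelated_def)
    qed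
  qed
  also have "\<dots> = (\<Sum>i\<in>I. E (\<lambda>\<omega>. (X i \<omega>)\<^sup>2)) + (\<Sum>i\<in>I. L (X i))\<^sup>2"
    using I by (simp add: sum.distrib sum.delta power2_eq_square sum_product)
  also have "(\<Sum>i\<in>I. L (X i))\<^sup>2 \<le> (\<Sum>i\<in>I. b i)\<^sup>2"
  proof (rule power2_le_iff_abs_le[THEN iffD2])
    show "\<bar>\<Sum>i\<in>I. L (X i)\<bar> \<le> (\<Sum>i\<in>I. b i)"
      using mean L by (intro order_trans[OF sum_abs] sum_mono) blast
    then show "0 \<le> (\<Sum>i\<in>I. b i)" by simp
  qed
  finally show ?thesis unfolding LE by simp
qed

text \<open>
  Ottaviani's argument for capacities. \<open>A k\<close> is the event that \<open>2\<epsilon>\<close> is first exceeded at time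
  \<open>k\<close>, and \<open>U k\<close> the event that the sum over \<open>{k<..n}\<close> exceeds \<open>\<epsilon>\<close>, both in absolute value. Outside \<open>U m\<close> the
  path must come back from level \<open>2\<epsilon>\<close> to level \<open>\<epsilon>\<close>, so some \<open>A k \<inter> U k\<close> occurs. The
  variation bound \<open>V\<close> replaces additivity when the \<open>C (A k)\<close> are summed.
\<close>
lemma maximal_inequality:
  assumes indep: "independent_under M E X" and X: "\<And>i. i \<ge> 1 \<Longrightarrow> X i \<in> bounded_measurable M"
    and V: "\<And>D n. range D \<subseteq> sets M \<Longrightarrow> disjoint_family D \<Longrightarrow> (\<Sum>i<n::nat. C (D i)) \<le> V"
    and pos: "0 < \<epsilon>" "0 \<le> \<delta>"
    and small: "\<And>k. m \<le> k \<Longrightarrow> k \<le> n \<Longrightarrow> C {\<omega>\<in>space M. \<bar>\<Sum>i\<in>{k<..n}. X i \<omega>\<bar> > \<epsilon>} \<le> \<delta>"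
  shows "C {\<omega>\<in>space M. \<exists>k\<in>{m<..n}. \<bar>\<Sum>i\<in>{m<..k}. X i \<omega>\<bar> > 2 * \<epsilon>} \<le> (1 + V) * \<delta>"
proof -
  define T where "T k \<omega> = (\<Sum>i\<in>{m<..k}. X i \<omega>)" for k \<omega>
  define U where "U k = {\<omega>\<in>space M. \<bar>\<Sum>i\<in>{k<..n}. X i \<omega>\<bar> > \<epsilon>}" for k
  define A where "A k = {\<omega>\<in>space M. m < k \<and> \<bar>T k \<omega>\<bar> > 2 * \<epsilon> \<and> (\<forall>j\<in>{m<..<k}. \<bar>T j \<omega>\<bar> \<le> 2 * \<epsilon>)}" for k
  have Xm: "X i \<in> borel_measurable M" if "i \<ge> 1" for i
    using X[OF that] by (simp add: bounded_measurable_iff)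
  have A_gen: "A k \<in> generated_sigma M X {1..k}" for k
  proof -
    let ?N = "generated_space M X {1..k}"
    have T[measurable]: "T j \<in> borel_measurable ?N" if "j \<le> k" for j
      unfolding T_def using that by (intro borel_measurable_sum measurable_generated_space) auto
    have "{\<omega>\<in>space ?N. m < k \<and> \<bar>T k \<omega>\<bar> > 2 * \<epsilon> \<and> (\<forall>j\<in>{m<..<k}. \<bar>T j \<omega>\<bar> \<le> 2 * \<epsilon>)} \<in> sets ?N"
      by measurable
    then show ?thesis by (simp add: A_def space_generated_space sets_generated_space)
  qed
  have U_gen: "U k \<in> generated_sigma M X {k+1..n}" for k
  proof -
    let ?N = "generated_space M X {k+1..n}"
    have [measurable]: "(\<lambda>\<omega>. \<Sum>i\<in>{k<..n}. X i \<omega>) \<in> borel_measurable ?N"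
      by (intro borel_measurable_sum measurable_generated_space) auto
    have "{\<omega>\<in>space ?N. \<bar>\<Sum>i\<in>{k<..n}. X i \<omega>\<bar> > \<epsilon>} \<in> sets ?N" by measurable
    then show ?thesis by (simp add: U_def space_generated_space sets_generated_space)
  qed
  have gen_sub: "generated_sigma M X I \<subseteq> sets M" if "I \<subseteq> {1..}" for I
    using Xm that by (intro generated_sigma_subset) auto
  have Am: "A k \<in> sets M" and Um: "U k \<in> sets M" for k
    using A_gen U_gen gen_sub[of "{1..k}"] gen_sub[of "{k+1..n}"] by auto
  let ?B = "{\<omega>\<in>space M. \<exists>k\<in>{m<..n}. \<bar>T k \<omega>\<bar> > 2 * \<epsilon>}"
  have cover: "?B \<subseteq> U m \<union> (\<Union>k\<in>{m<..<n}. A k \<inter> U k)"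
  proof safe
    fix \<omega> k assume \<omega>: "\<omega> \<in> space M" and k: "k \<in> {m<..n}" "2 * \<epsilon> < \<bar>T k \<omega>\<bar>"
      and not: "\<omega> \<notin> (\<Union>k\<in>{m<..<n}. A k \<inter> U k)"
    define j where "j = (LEAST k. k \<in> {m<..n} \<and> 2 * \<epsilon> < \<bar>T k \<omega>\<bar>)"
    have j: "j \<in> {m<..n}" "2 * \<epsilon> < \<bar>T j \<omega>\<bar>" 
      using LeastI[of "\<lambda>k. k \<in> {m<..n} \<and> 2 * \<epsilon> < \<bar>T k \<omega>\<bar>" k] k unfolding j_def by blast+
    have "\<bar>T i \<omega>\<bar> \<le> 2 * \<epsilon>" if "i \<in> {m<..<j}" for i
      using not_less_Least[of i "\<lambda>k. k \<in> {m<..n} \<and> 2 * \<epsilon> < \<bar>T k \<omega>\<bar>"] that j(1) unfolding j_def[symmetric]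
      by auto
    then have jA: "\<omega> \<in> A j" using \<omega> j by (auto simp: A_def)
    have split: "T n \<omega> = T j \<omega> + (\<Sum>i\<in>{j<..n}. X i \<omega>)"
    proof -
      have "{m<..n} = {m<..j} \<union> {j<..n}" using j(1) by auto
      then show ?thesis unfolding T_def by (simp add: sum.union_disjoint ivl_disj_int)
    qed
    \<comment> \<open>For \<open>j = n\<close> the remaining sum is empty, so positivity of \<open>\<epsilon>\<close> is used.\<close>
    have "\<bar>\<Sum>i\<in>{j<..n}. X i \<omega>\<bar> \<le> \<epsilon>"
    proof (cases "j = n")
      case True
      then show ?thesis using pos by simp
    next
      case False
      then show ?thesis using not jA j(1) \<omega> by (auto simp: U_def)
    qed
    then have "\<bar>T n \<omega>\<bar> > \<epsilon>" using split j(2) by linarith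
    then show "\<omega> \<in> U m" using \<omega> by (simp add: U_def T_def)
  qed
  have B: "?B \<in> sets M"
  proof -
    have "T k \<in> borel_measurable M" for k
      unfolding T_def by (intro borel_measurable_sum Xm) auto
    then show ?thesis by measurable
  qed
  have "C ?B \<le> (1 + V) * \<delta>"
  proof (cases "m < n")
    case False
    then have "?B = {}" by auto
    then have "C ?B = 0" using capacity_empty by (simp only:)
    moreover have "0 \<le> V" using V[of "\<lambda>_. {}" 0] by (simp add: disjoint_family_on_def)
    ultimately show ?thesis using pos by simp
  next
    case True
    have "C (A k \<inter> U k) \<le> C (A k) * \<delta>" if k: "k \<in> {m<..<n}" for k
    proof -
      have "1 \<le> k" "k < n" using k by auto
      then have "C (A k \<inter> U k) \<le> C (A k) * C (U k)"
        using indep A_gen[of k] U_gen[of k] unfolding independent_under_def by blast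
      also have "\<dots> \<le> C (A k) * \<delta>"
        using small[of k] k by (intro mult_left_mono capacity_nonneg Am) (auto simp: U_def)
      finally show ?thesis .
    qed
    then have "(\<Sum>k\<in>{m<..<n}. C (A k \<inter> U k)) \<le> (\<Sum>k\<in>{m<..<n}. C (A k)) * \<delta>"
      unfolding sum_distrib_right by (intro sum_mono)
    also have "(\<Sum>k\<in>{m<..<n}. C (A k)) \<le> (\<Sum>k<n. C (A k))"
      by (intro sum_mono2) (auto intro: capacity_nonneg Am)
    also have "\<dots> \<le> V"
    proof (rule V)
      have disj: "A j \<inter> A k = {}" if "j < k" for j k
      proof (rule equals0I)
        fix \<omega> assume "\<omega> \<in> A j \<inter> A k"
        then have "j \<in> {m<..<k}" "\<bar>T j \<omega>\<bar> > 2 * \<epsilon>" "\<forall>j\<in>{m<..<k}. \<bar>T j \<omega>\<bar> \<le> 2 * \<epsilon>"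
          using that by (simp_all add: A_def)
        then show False by (meson not_le)
      qed
      show "disjoint_family A"
        unfolding disjoint_family_on_def by (metis disj Int_commute nat_neq_iff)
      show "range A \<subseteq> sets M" using Am by blast
    qed
    finally have sum_le: "(\<Sum>k\<in>{m<..<n}. C (A k \<inter> U k)) \<le> V * \<delta>"
      using pos by (simp add: mult_right_mono)
    have "C ?B \<le> C (U m \<union> (\<Union>k\<in>{m<..<n}. A k \<inter> U k))"
      using Am Um by (intro capacity_mono B cover) (auto intro!: sets.finite_UN)
    also have "\<dots> \<le> C (U m) + C (\<Union>k\<in>{m<..<n}. A k \<inter> U k)"
      using Am Um by (intro capacity_subadditive) (auto intro!: sets.finite_UN)
    also have "C (\<Union>k\<in>{m<..<n}. A k \<inter> U k) \<le> (\<Sum>k\<in>{m<..<n}. C (A k \<inter> U k))"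
      using Am Um by (intro capacity_finite_subadditive) auto
    finally have "C ?B \<le> \<delta> + V * \<delta>"
      using sum_le small[of m] True by (simp add: U_def)
    then show ?thesis by (simp add: algebra_simps)
  qed
  then show ?thesis by (simp only: T_def)
qed

text \<open>
  Since the bound of the maximal inequality does not involve \<open>n\<close>, continuity from below extends it to
  the supremum over all later times.
\<close>
lemma tail_oscillation:
  assumes indep: "independent_under M E X" and X: "\<And>i. i \<ge> 1 \<Longrightarrow> X i \<in> bounded_measurable M"
    and V: "\<And>D n. range D \<subseteq> sets M \<Longrightarrow> disjoint_family D \<Longrightarrow> (\<Sum>i<n::nat. C (D i)) \<le> V"
    and mean: "\<And>i. i \<ge> 1 \<Longrightarrow> \<forall>L\<in>dominated_linear M E. \<bar>L (X i)\<bar> \<le> b i"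
    and b: "summable b" and var: "summable (\<lambda>i. E (\<lambda>\<omega>. (X i \<omega>)\<^sup>2))"
    and pos: "0 < \<epsilon>" "0 < \<eta>"
  shows "\<exists>m. C {\<omega>\<in>space M. \<exists>k>m. \<bar>\<Sum>i\<in>{m<..k}. X i \<omega>\<bar> > 2 * \<epsilon>} \<le> \<eta>"
proof -
  have V0: "0 \<le> V" using V[of "\<lambda>_. {}" 0] by (simp add: disjoint_family_on_def)
  define \<delta> where "\<delta> = \<eta> / (1 + V)"
  have \<delta>: "0 < \<delta>" "(1 + V) * \<delta> = \<eta>" using V0 pos by (auto simp: \<delta>_def)
  \<comment> \<open>Chebyshev at level \<open>\<epsilon>\<close> needs second moments below \<open>\<delta> \<epsilon>\<^sup>2\<close>; variances and means get one half each.\<close>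
  define \<tau> where "\<tau> = \<delta> * \<epsilon>\<^sup>2 / 2"
  have \<tau>: "0 < \<tau>" "2 * \<tau> / \<epsilon>\<^sup>2 = \<delta>" using \<delta> pos by (auto simp: \<tau>_def)
  obtain m1 where m1: "\<And>k n. m1 \<le> k \<Longrightarrow> norm (\<Sum>i\<in>{k..<n}. E (\<lambda>\<omega>. (X i \<omega>)\<^sup>2)) < \<tau>"
    using var \<tau>(1) unfolding summable_Cauchy by metis
  obtain m2 where m2: "\<And>k n. m2 \<le> k \<Longrightarrow> norm (sum b {k..<n}) < sqrt \<tau>"
    using b \<tau>(1) unfolding summable_Cauchy by (metis real_sqrt_gt_zero)
  define m where "m = max m1 m2"
  have small: "C {\<omega>\<in>space M. \<bar>\<Sum>i\<in>{k<..n}. X i \<omega>\<bar> > \<epsilon>} \<le> \<delta>" if "m \<le> k" for k n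
  proof -
    have Xk: "X i \<in> bounded_measurable M" if "i \<in> {k<..n}" for i using X that by auto
    have ivl: "{k<..n} = {Suc k..<Suc n}" by auto
    have "\<bar>\<Sum>i\<in>{k<..n}. b i\<bar> \<le> sqrt \<tau>"
      using m2[of "Suc k" "Suc n"] that unfolding ivl by (simp add: m_def)
    then have "(\<Sum>i\<in>{k<..n}. b i)\<^sup>2 \<le> \<tau>"
      using \<tau>(1) power_mono[of "\<bar>\<Sum>i\<in>{k<..n}. b i\<bar>" "sqrt \<tau>" 2] by simp
    moreover have "(\<Sum>i\<in>{k<..n}. E (\<lambda>\<omega>. (X i \<omega>)\<^sup>2)) \<le> \<tau>"
      using m1[of "Suc k" "Suc n"] that unfolding ivl by (simp add: m_def)
    moreover have "E (\<lambda>\<omega>. (\<Sum>i\<in>{k<..n}. X i \<omega>)\<^sup>2) \<le>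
        (\<Sum>i\<in>{k<..n}. E (\<lambda>\<omega>. (X i \<omega>)\<^sup>2)) + (\<Sum>i\<in>{k<..n}. b i)\<^sup>2"
    proof (rule second_moment_sum)
      show "uncorrelated M E (X i) (X j)" if "i \<in> {k<..n}" "j \<in> {k<..n}" "i \<noteq> j" for i j
        using indep that by (auto simp: independent_under_def)
    qed (use Xk mean in auto)
    ultimately have E2: "E (\<lambda>\<omega>. (\<Sum>i\<in>{k<..n}. X i \<omega>)\<^sup>2) \<le> 2 * \<tau>" by simp
    have "C {\<omega>\<in>space M. \<bar>\<Sum>i\<in>{k<..n}. X i \<omega>\<bar> > \<epsilon>} \<le> E (\<lambda>\<omega>. (\<Sum>i\<in>{k<..n}. X i \<omega>)\<^sup>2) / \<epsilon>\<^sup>2"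
      by (intro chebyshev bounded_measurable_sum Xk pos)
    also have "\<dots> \<le> 2 * \<tau> / \<epsilon>\<^sup>2" using E2 by (intro divide_right_mono) auto
    finally show ?thesis unfolding \<tau>(2) .
  qed
  let ?A = "\<lambda>n. {\<omega>\<in>space M. \<exists>k\<in>{m<..n}. \<bar>\<Sum>i\<in>{m<..k}. X i \<omega>\<bar> > 2 * \<epsilon>}"
  have "C (\<Union>n. ?A n) \<le> \<eta>"
  proof (rule capacity_incseq_le)
    have [measurable]: "(\<lambda>\<omega>. \<Sum>i\<in>{m<..k}. X i \<omega>) \<in> borel_measurable M" for k
      using X by (intro borel_measurable_sum) (auto simp: bounded_measurable_iff)
    have "?A n \<in> sets M" for n by measurable
    then show "range ?A \<subseteq> sets M" by auto
    show "incseq ?A" by (force simp: incseq_def)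
    fix n
    have "C (?A n) \<le> (1 + V) * \<delta>"
      by (rule maximal_inequality[OF indep X V pos(1) less_imp_le[OF \<delta>(1)]]) (assumption | rule small)+
    then show "C (?A n) \<le> \<eta>" unfolding \<delta>(2) .
  qed
  moreover have "(\<Union>n. ?A n) = {\<omega>\<in>space M. \<exists>k>m. \<bar>\<Sum>i\<in>{m<..k}. X i \<omega>\<bar> > 2 * \<epsilon>}"
  proof (intro equalityI subsetI)
    fix \<omega> assume "\<omega> \<in> {\<omega>\<in>space M. \<exists>k>m. \<bar>\<Sum>i\<in>{m<..k}. X i \<omega>\<bar> > 2 * \<epsilon>}"
    then obtain k where "\<omega> \<in> space M" "k \<in> {m<..k}" "\<bar>\<Sum>i\<in>{m<..k}. X i \<omega>\<bar> > 2 * \<epsilon>" by auto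
    then have "\<omega> \<in> ?A k" by blast
    then show "\<omega> \<in> (\<Union>n. ?A n)" by blast
  qed auto
  ultimately show ?thesis by auto
qed

text \<open>
  A Kolmogorov-type one-series theorem. A path whose partial sums are not Cauchy moves by more than some fixed
  \<open>2 \<epsilon> j\<close> after every time \<open>m\<close>; for fixed \<open>j\<close> the set of these paths is null because the
  capacities of the sets \<open>B j m\<close> become arbitrarily small.
\<close>
lemma quasi_sure_convergence:
  assumes indep: "independent_under M E X" and X: "\<And>i. i \<ge> 1 \<Longrightarrow> X i \<in> bounded_measurable M"
    and V: "\<And>D n. range D \<subseteq> sets M \<Longrightarrow> disjoint_family D \<Longrightarrow> (\<Sum>i<n::nat. C (D i)) \<le> V"
    and mean: "\<And>i. i \<ge> 1 \<Longrightarrow> \<forall>L\<in>dominated_linear M E. \<bar>L (X i)\<bar> \<le> b i"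
    and b: "summable b" and var: "summable (\<lambda>i. E (\<lambda>\<omega>. (X i \<omega>)\<^sup>2))"
  shows "quasi_surely M E (\<lambda>\<omega>. convergent (\<lambda>n. \<Sum>i=1..n. X i \<omega>))"
proof -
  define \<epsilon> where "\<epsilon> j = 1 / real (Suc j)" for j
  define B where "B j m = {\<omega>\<in>space M. \<exists>k>m. \<bar>\<Sum>i\<in>{m<..k}. X i \<omega>\<bar> > 2 * \<epsilon> j}" for j m
  have [measurable]: "(\<lambda>\<omega>. \<Sum>i\<in>{m<..k}. X i \<omega>) \<in> borel_measurable M" for m k
    using X by (intro borel_measurable_sum) (auto simp: bounded_measurable_iff)
  have Bm: "B j m \<in> sets M" for j m unfolding B_def by measurable
  have INT: "(\<Inter>m. B j m) \<in> sets M" for j using Bm by (intro sets.countable_INT) auto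
  have null: "C (\<Inter>m. B j m) = 0" for j
  proof (rule antisym[OF _ capacity_nonneg[OF INT]], rule field_le_epsilon)
    fix \<eta> :: real assume \<eta>: "0 < \<eta>"
    have "0 < \<epsilon> j" by (simp add: \<epsilon>_def)
    then obtain m where m: "C (B j m) \<le> \<eta>"
      using tail_oscillation[OF indep X V mean b var _ \<eta>] unfolding B_def by blast
    have "C (\<Inter>m. B j m) \<le> C (B j m)" by (intro capacity_mono INT Bm) auto
    then show "C (\<Inter>m. B j m) \<le> 0 + \<eta>" using m by simp
  qed
  show ?thesis
    unfolding quasi_surely_def
  proof (intro exI conjI ballI)
    show "polar M E (\<Union>j. \<Inter>m. B j m)"
      unfolding polar_def using INT by (auto intro!: capacity_null_UN null)
    fix \<omega> assume \<omega>: "\<omega> \<in> space M - (\<Union>j. \<Inter>m. B j m)"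
    let ?S = "\<lambda>n. \<Sum>i=1..n. X i \<omega>"
    have "Cauchy ?S"
    proof (rule metric_CauchyI)
      fix e :: real assume e: "0 < e"
      obtain j where j: "4 * \<epsilon> j < e"
        using reals_Archimedean[of "e / 4"] e by (auto simp: \<epsilon>_def inverse_eq_divide)
      obtain m where "\<omega> \<notin> B j m" using \<omega> by blast
      then have "\<bar>\<Sum>i\<in>{m<..k}. X i \<omega>\<bar> \<le> 2 * \<epsilon> j" if "k > m" for k
        using \<omega> that by (auto simp: B_def not_less[symmetric])
      then have m: "\<bar>\<Sum>i\<in>{m<..k}. X i \<omega>\<bar> \<le> 2 * \<epsilon> j" if "k \<ge> m" for k
        using that by (cases "k = m") (auto simp: \<epsilon>_def)
      have S: "?S k = ?S m + (\<Sum>i\<in>{m<..k}. X i \<omega>)" if "k \<ge> m" for k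
      proof -
        have "{1..k} = {1..m} \<union> {m<..k}" using that by auto
        then show ?thesis by (simp add: sum.union_disjoint ivl_disj_int)
      qed
      have "dist (?S k) (?S l) < e" if "k \<ge> m" "l \<ge> m" for k l
        using m[OF that(1)] m[OF that(2)] S[OF that(1)] S[OF that(2)] j by (simp add: dist_real_def)
      then show "\<exists>M. \<forall>k\<ge>M. \<forall>l\<ge>M. dist (?S k) (?S l) < e" by blast
    qed
    then show "convergent ?S" by (rule Cauchy_convergent)
  qed
qed

end

section \<open>Kronecker's lemma\<close>

text \<open>
  Beyond an index \<open>N\<close> the terms \<open>r i\<close> are at most \<open>e / 2\<close> and their weights telescope to at
  most \<open>w n\<close>, up to a constant; the finitely many earlier terms are negligible against \<open>w n\<close>.
\<close>
lemma weighted_average_tendsto_zero: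
  fixes r w :: "nat \<Rightarrow> real"
  assumes r: "r \<longlonglongrightarrow> 0" and w: "incseq w" "filterlim w at_top sequentially"
  shows "(\<lambda>n. (\<Sum>i<n. (w (Suc i) - w i) * r i) / w n) \<longlonglongrightarrow> 0"
proof (rule LIMSEQ_I)
  fix e :: real assume e: "0 < e"
  have d: "0 \<le> w (Suc i) - w i" for i using w(1) by (simp add: incseq_SucD)
  obtain N where N: "\<And>i. i \<ge> N \<Longrightarrow> \<bar>r i\<bar> < e / 2"
    using LIMSEQ_D[OF r, of "e / 2"] e by auto
  define K where "K = (\<Sum>i<N. (w (Suc i) - w i) * \<bar>r i\<bar>) - (e / 2) * w 0"
  have bound: "\<bar>\<Sum>i<n. (w (Suc i) - w i) * r i\<bar> \<le> K + (e / 2) * w n" for n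
  proof -
    have "\<bar>\<Sum>i<n. (w (Suc i) - w i) * r i\<bar> \<le> (\<Sum>i<n. (w (Suc i) - w i) * \<bar>r i\<bar>)"
      using d by (intro order_trans[OF sum_abs] sum_mono) (simp add: abs_mult)
    also have "\<dots> \<le> (\<Sum>i<n. (if i < N then (w (Suc i) - w i) * \<bar>r i\<bar> else 0) + (e / 2) * (w (Suc i) - w i))"
    proof (intro sum_mono)
      fix i
      have "(w (Suc i) - w i) * \<bar>r i\<bar> \<le> (e / 2) * (w (Suc i) - w i)" if "\<not> i < N"
        using mult_right_mono[OF less_imp_le[OF N] d, of i] that by (simp add: mult.commute)
      then show "(w (Suc i) - w i) * \<bar>r i\<bar> \<le>
          (if i < N then (w (Suc i) - w i) * \<bar>r i\<bar> else 0) + (e / 2) * (w (Suc i) - w i)"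
        using d[of i] e by auto
    qed
    also have "\<dots> = (\<Sum>i\<in>{..<n} \<inter> {..<N}. (w (Suc i) - w i) * \<bar>r i\<bar>) + (e / 2) * (\<Sum>i<n. w (Suc i) - w i)"
      by (simp add: sum.distrib sum_distrib_left sum.inter_restrict)
    also have "(\<Sum>i<n. w (Suc i) - w i) = w n - w 0" by (rule sum_lessThan_telescope)
    also have "(\<Sum>i\<in>{..<n} \<inter> {..<N}. (w (Suc i) - w i) * \<bar>r i\<bar>) \<le> (\<Sum>i<N. (w (Suc i) - w i) * \<bar>r i\<bar>)"
      using d by (intro sum_mono2) auto
    finally show ?thesis by (simp only: K_def right_diff_distrib) linarith
  qed
  have "eventually (\<lambda>n. w n > max 0 (2 * K / e)) sequentially"
    using w(2)[unfolded filterlim_at_top_dense] by (rule spec)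
  then obtain N' where N': "\<And>n. n \<ge> N' \<Longrightarrow> w n > max 0 (2 * K / e)"
    by (auto simp: eventually_sequentially)
  have "norm ((\<Sum>i<n. (w (Suc i) - w i) * r i) / w n - 0) < e" if "n \<ge> N'" for n
  proof -
    have wn: "w n > 0" "K < (e / 2) * w n" using N'[OF that] e by (auto simp: field_simps)
    then have "\<bar>\<Sum>i<n. (w (Suc i) - w i) * r i\<bar> < e * w n" using bound[of n] by simp
    then show ?thesis using wn(1) by (simp add: abs_div field_simps)
  qed
  then show "\<exists>N. \<forall>n\<ge>N. norm ((\<Sum>i<n. (w (Suc i) - w i) * r i) / w n - 0) < e" by blast
qed

text \<open>
  Summation by parts, with the partial sums centred at their limit \<open>s\<close>, reduces the claim to a
  weighted average of a null sequence.
\<close>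
lemma kronecker:
  fixes x w :: "nat \<Rightarrow> real"
  assumes conv: "convergent (\<lambda>n. \<Sum>i=1..n. x i)"
    and w: "incseq w" "filterlim w at_top sequentially"
  shows "(\<lambda>n. (\<Sum>i=1..n. w i * x i) / w n) \<longlonglongrightarrow> 0"
proof -
  obtain s where s: "(\<lambda>n. \<Sum>i=1..n. x i) \<longlonglongrightarrow> s" using conv by (auto simp: convergent_def)
  define r where "r n = (\<Sum>i=1..n. x i) - s" for n
  have r: "r \<longlonglongrightarrow> 0" unfolding r_def using s by (rule LIM_zero)
  have parts: "(\<Sum>i=1..n. w i * x i) = w n * r n - w 0 * r 0 - (\<Sum>i<n. (w (Suc i) - w i) * r i)" for n
  proof (induction n)
    case (Suc n)
    have "(\<Sum>i=1..Suc n. w i * x i) = (\<Sum>i=1..n. w i * x i) + w (Suc n) * (r (Suc n) - r n)"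
      by (simp add: r_def)
    then show ?case using Suc by (simp add: algebra_simps)
  qed simp
  have "(\<lambda>n. r n - w 0 * r 0 / w n - (\<Sum>i<n. (w (Suc i) - w i) * r i) / w n) \<longlonglongrightarrow> 0 - 0 - 0"
    by (intro tendsto_diff r weighted_average_tendsto_zero w tendsto_divide_0[OF tendsto_const]
        filterlim_at_top_imp_at_infinity)
  moreover have "eventually (\<lambda>n. r n - w 0 * r 0 / w n - (\<Sum>i<n. (w (Suc i) - w i) * r i) / w n =
      (\<Sum>i=1..n. w i * x i) / w n) sequentially"
    using filterlim_at_top_dense[THEN iffD1, OF w(2), rule_format, of 0]
    by eventually_elim (unfold parts, simp add: diff_divide_distrib)
  ultimately show ?thesis by (auto intro: Lim_transform_eventually)
qed

section \<open>The strong law\<close>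

theorem theorem3p7:
  fixes M :: "'a measure"
    and E :: "('a \<Rightarrow> real) \<Rightarrow> real"
    and \<xi> :: "nat \<Rightarrow> 'a \<Rightarrow> real"
    and p :: real
  assumes "sublinear_expectation M E"
    and "regular_expectation M E"
    and "\<And>A :: nat \<Rightarrow> 'a set. range A \<subseteq> sets M \<Longrightarrow> (\<Union>n. A n) = space M \<Longrightarrow> disjoint_family A \<Longrightarrow>
           \<exists>K. summable (\<lambda>n. capacity E (A n)) \<and> (\<Sum>n. capacity E (A n)) < K"
    and "\<And>i. i \<ge> 1 \<Longrightarrow> \<xi> i \<in> bounded_measurable M"
    and "independent_under M E \<xi>"
    and "p > 1"
    and "bdd_above ((\<lambda>i. E (\<xi> i) + E (\<lambda>\<omega>. - \<xi> i \<omega>)) ` {1..})"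
    and "summable (\<lambda>i. 1 / real (Suc i) powr (2 * p) *
           E (\<lambda>\<omega>. (\<xi> (Suc i) \<omega> - E (\<xi> (Suc i)))\<^sup>2))"
  shows "\<exists>l :: nat \<Rightarrow> real.
           quasi_surely M E
             (\<lambda>\<omega>. (\<lambda>n. 1 / real n powr p * (\<Sum>i=1..n. \<xi> i \<omega> - l i)) \<longlonglongrightarrow> 0)"
proof -
  interpret regular_sublinear M E by (rule regular_sublinear.intro[OF assms(1,2)])
  note \<xi> = assms(4)
  define l where "l i = E (\<xi> i)" for i
  define a where "a i = 1 / real i powr p" for i
  define X where "X i \<omega> = a i * (\<xi> i \<omega> - l i)" for i \<omega>
  obtain V where V: "\<And>D n. range D \<subseteq> sets M \<Longrightarrow> disjoint_family D \<Longrightarrow> (\<Sum>i<n::nat. C (D i)) \<le> V"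
    using finite_variation assms(3) by metis
  obtain G where G: "\<And>i. i \<ge> 1 \<Longrightarrow> E (\<xi> i) + E (\<lambda>\<omega>. - \<xi> i \<omega>) \<le> G"
    using assms(7) by (auto simp: bdd_above_def)
  have X_bm: "X i \<in> bounded_measurable M" if "i \<ge> 1" for i
    unfolding X_def[abs_def] using \<xi>[OF that] by (intro bounded_measurable_scale bounded_measurable_shift)
  have X_indep: "independent_under M E X"
    unfolding X_def[abs_def] by (rule independent_under_affine[OF assms(1,5) \<xi>])
  have X_mean: "\<forall>L\<in>dominated_linear M E. \<bar>L (X i)\<bar> \<le> G * a i" if i: "i \<ge> 1" for i
  proof
    fix L assume L: "L \<in> dominated_linear M E"
    have le: "L f \<le> E f" if "f \<in> bounded_measurable M" for f
      using L that by (auto simp: dominated_linear_def)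
    have scale: "L (\<lambda>\<omega>. c * f \<omega>) = c * L f" if "f \<in> bounded_measurable M" for f c
      using L that by (auto simp: dominated_linear_def)
    have "L (\<lambda>\<omega>. \<xi> i \<omega> + - l i) = L (\<xi> i) + L (\<lambda>\<omega>. - l i)"
      using L \<xi>[OF i] bounded_measurable_const[of "- l i" M] by (auto simp: dominated_linear_def)
    then have "L (\<lambda>\<omega>. \<xi> i \<omega> - l i) = L (\<xi> i) - l i"
      using dominated_linear_const[OF assms(1) L, of "- l i"] by simp
    then have LX: "L (X i) = a i * (L (\<xi> i) - l i)"
      unfolding X_def[abs_def] using scale[OF bounded_measurable_shift[OF \<xi>[OF i]]] by simp
    \<comment> \<open>The mean of \<open>\<xi> i\<close> lies between \<open>- E (- \<xi> i)\<close> and \<open>E (\<xi> i)\<close>, an interval of length at most \<open>G\<close>.\<close>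
    have "L (\<xi> i) \<le> l i" unfolding l_def by (rule le[OF \<xi>[OF i]])
    moreover have "- L (\<xi> i) \<le> E (\<lambda>\<omega>. - \<xi> i \<omega>)"
      using le[OF bounded_measurable_uminus[OF \<xi>[OF i]]] scale[OF \<xi>[OF i], of "-1"] by simp
    ultimately have "\<bar>L (\<xi> i) - l i\<bar> \<le> G" using G[OF i] by (simp add: l_def)
    then show "\<bar>L (X i)\<bar> \<le> G * a i" unfolding LX by (simp add: abs_mult a_def divide_right_mono)
  qed
  have a_sum: "summable (\<lambda>i. G * a i)"
    using summable_real_powr_iff[of "- p"] assms(6)
    by (intro summable_mult) (simp add: a_def powr_minus_divide)
  have "E (\<lambda>\<omega>. (X i \<omega>)\<^sup>2) = 1 / real i powr (2 * p) * E (\<lambda>\<omega>. (\<xi> i \<omega> - E (\<xi> i))\<^sup>2)" if "i \<ge> 1" for i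
  proof -
    have "(a i)\<^sup>2 = 1 / real i powr (2 * p)"
      by (simp add: a_def power2_eq_square powr_add[symmetric])
    moreover have "E (\<lambda>\<omega>. (a i)\<^sup>2 * (\<xi> i \<omega> - l i)\<^sup>2) = (a i)\<^sup>2 * E (\<lambda>\<omega>. (\<xi> i \<omega> - l i)\<^sup>2)"
      using \<xi>[OF that] by (intro scale bounded_measurable_power2 bounded_measurable_shift) auto
    ultimately show ?thesis by (simp add: X_def power_mult_distrib l_def)
  qed
  then have "summable (\<lambda>i. E (\<lambda>\<omega>. (X (Suc i) \<omega>)\<^sup>2))" using assms(8) by simp
  then have X_var: "summable (\<lambda>i. E (\<lambda>\<omega>. (X i \<omega>)\<^sup>2))" by (subst (asm) summable_Suc_iff)
  have w: "incseq (\<lambda>n. real n powr p)" "filterlim (\<lambda>n. real n powr p) at_top sequentially"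
    using assms(6) 
    by (auto simp: incseq_def intro!: powr_mono2 filterlim_compose[OF real_powr_at_top filterlim_real_sequentially])
  have "quasi_surely M E (\<lambda>\<omega>. convergent (\<lambda>n. \<Sum>i=1..n. X i \<omega>))"
    by (rule quasi_sure_convergence[OF X_indep X_bm V X_mean a_sum X_var])
  moreover have "(\<lambda>n. 1 / real n powr p * (\<Sum>i=1..n. \<xi> i \<omega> - l i)) \<longlonglongrightarrow> 0"
    if "convergent (\<lambda>n. \<Sum>i=1..n. X i \<omega>)" for \<omega>
  proof -
    have "(\<Sum>i=1..n. real i powr p * X i \<omega>) = (\<Sum>i=1..n. \<xi> i \<omega> - l i)" for n
      by (intro sum.cong) (auto simp: X_def a_def)
    then show ?thesis using kronecker[OF that w] by simp
  qed
  ultimately show ?thesis unfolding quasi_surely_def by blast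
qed

end
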